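(* Let $n\ge 2$ and let $A=[a_{ij}]$ be a real symmetric $(n+1)\times(n+1)$ matrix with $a_{ii}=1$ for all $i$. Then: (a) $A\in\overline{\mathcal{Z}}_{n+1}$ if and only if $\det(A)=0$, $A$ is positive semi-definite, and there exists a principal $(k+1)\times(k+1)$ submatrix $B$ of $A$ (for some integer $k$ with $0\le k\le n$) such that $\det(B)=0$, $ad(B)\ge 0$ and $ad(B)\ne 0$. (b) $A\in\overline{\mathcal{X}}_{n+1}$ if and only if either $A\in\mathcal{X}_{n+1}$ or there exists a diagonal matrix $D=diag(\varepsilon_1,\dots,\varepsilon_{n+1})$, with $\varepsilon_i\in\{1,-1\}$ for each $i=1,\dots,n+1$, such that $DAD\in\overline{\mathcal{Z}}_{n+1}$. (c) $A\in\overline{\mathcal{Y}}_{n+1}$ if and only if either $A\in\overline{\mathcal{Z}}_{n+1}$, or $\det(A)<0$, $ad(A)\ge 0$ and all principal $n\times n$ submatrices of $A$ are positive semi-definite.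
   Context: Simplexes are non-degenerate and compact. Given an $n$-simplex in spherical, hyperbolic or Euclidean $n$-space with vertices $u_1,\dots,u_{n+1}$, its $i$-th codimension-1 face is the $(n-1)$-simplex with vertices $u_1,\dots,u_{i-1},u_{i+1},\dots,u_{n+1}$. For $i\ne j$, $\theta_{ij}$ denotes the (interior) dihedral angle between the $i$-th and $j$-th codimension-1 faces, and by convention $\theta_{ii}=\pi$. The angle Gram matrix of the simplex is the symmetric $(n+1)\times(n+1)$ matrix $[-\cos(\theta_{ij})]$. $\mathcal{X}_{n+1},\mathcal{Y}_{n+1},\mathcal{Z}_{n+1}\subset\mathbf{R}^{(n+1)\times(n+1)}$ denote the sets of angle Gram matrices of all spherical, hyperbolic, and Euclidean $n$-simplexes respectively. An overline denotes the closure in $\mathbf{R}^{(n+1)\times(n+1)}$. For a real matrix $M=[m_{ij}]$, $M\ge 0$ means $m_{ij}\ge0$ for all $i,j$ (entrywise). $ad(M)$ is the adjoint (adjugate) matrix of $M$. A principal submatrix is one obtained by keeping the rows and columns indexed by the same subset of indices. $diag(x_1,\dots,x_k)$ is the diagonal matrix with the given diagonal entries. *)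

theory Defs
  imports "HOL-Analysis.Analysis"
begin

text \<open>
  The dimension \<open>n\<close> is \<open>CARD('m)\<close>. The \<open>n + 1\<close> vertices of an \<open>n\<close>-simplex, and the rows and
  columns of its Gram matrix, are indexed by \<open>'m option\<close>. A simplex is given by its tuple of vertices.
  Euclidean \<open>n\<close>-space is \<open>real^'m\<close>; the unit sphere and the hyperboloid model of hyperbolic
  \<open>n\<close>-space live in \<open>real^('m option)\<close>, where \<open>None\<close> is the time-like coordinate of the latter.
\<close>

definition euclidean_simplex :: "('m::finite option \<Rightarrow> real^'m) \<Rightarrow> bool" where
  "euclidean_simplex u \<longleftrightarrow> inj u \<and> \<not> affine_dependent (range u)"

definition spherical_simplex :: "('m::finite option \<Rightarrow> real^('m option)) \<Rightarrow> bool" where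
  "spherical_simplex u \<longleftrightarrow> (\<forall>i. u i \<in> sphere 0 1) \<and> inj u \<and> independent (range u)"

definition lorentz :: "real^('m::finite option) \<Rightarrow> real^('m option) \<Rightarrow> real" where
  "lorentz x y = (\<Sum>k\<in>UNIV. x $ Some k * y $ Some k) - x $ None * y $ None"

definition hyperboloid :: "(real^('m::finite option)) set" where
  "hyperboloid = {x. lorentz x x = -1 \<and> x $ None > 0}"

definition hyperbolic_simplex :: "('m::finite option \<Rightarrow> real^('m option)) \<Rightarrow> bool" where
  "hyperbolic_simplex u \<longleftrightarrow> (\<forall>i. u i \<in> hyperboloid) \<and> inj u \<and> independent (range u)"

text \<open>
  Foot of the \<open>\<beta>\<close>-perpendicular from \<open>x\<close> to the affine (possibly linear) subspace \<open>L\<close>; it is only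
  used where \<open>\<beta>\<close> is nondegenerate on the direction space of \<open>L\<close>, so that it exists uniquely.
\<close>

definition foot :: "('v \<Rightarrow> 'v \<Rightarrow> real) \<Rightarrow> 'v set \<Rightarrow> 'v \<Rightarrow> 'v::real_vector" where
  "foot \<beta> L x = (THE q. q \<in> L \<and> (\<forall>y\<in>L. \<beta> (x - q) (y - q) = 0))"

definition form_angle :: "('v \<Rightarrow> 'v \<Rightarrow> real) \<Rightarrow> 'v \<Rightarrow> 'v \<Rightarrow> real" where
  "form_angle \<beta> v w = arccos (\<beta> v w / (sqrt (\<beta> v v) * sqrt (\<beta> w w)))"

text \<open>
  The codimension-1 faces opposite to \<open>u i\<close> and \<open>u j\<close> meet in the codimension-2 face \<open>F\<close> with vertices
  \<open>u k\<close>, \<open>k \<noteq> i, j\<close>, which spans \<open>L\<close>: its affine hull in Euclidean space, its linear span in the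
  spherical and hyperbolic models. The face opposite to \<open>u i\<close> is spanned by \<open>F\<close> and \<open>u j\<close>, so the
  normal to \<open>F\<close> pointing into it is the component of \<open>u j\<close> perpendicular to \<open>L\<close>, which is also
  tangent to the sphere resp. hyperboloid along \<open>F\<close>. The interior dihedral angle is the angle between
  the two normals so obtained.
\<close>

definition dihedral_angle ::
  "('v \<Rightarrow> 'v \<Rightarrow> real) \<Rightarrow> ('v set \<Rightarrow> 'v set) \<Rightarrow> ('i \<Rightarrow> 'v::real_vector) \<Rightarrow> 'i \<Rightarrow> 'i \<Rightarrow> real" where
  "dihedral_angle \<beta> hl u i j =
     (if i = j then pi
      else let L = hl (u ` (- {i, j}))
           in form_angle \<beta> (u j - foot \<beta> L (u j)) (u i - foot \<beta> L (u i)))"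

definition angle_gram ::
  "('v \<Rightarrow> 'v \<Rightarrow> real) \<Rightarrow> ('v set \<Rightarrow> 'v set) \<Rightarrow> ('i::finite \<Rightarrow> 'v::real_vector) \<Rightarrow> real^'i^'i" where
  "angle_gram \<beta> hl u = (\<chi> i j. - cos (dihedral_angle \<beta> hl u i j))"

definition spherical_grams :: "(real^('m::finite option)^('m option)) set" where
  "spherical_grams = {angle_gram (\<bullet>) span u | u. spherical_simplex u}"

definition hyperbolic_grams :: "(real^('m::finite option)^('m option)) set" where
  "hyperbolic_grams = {angle_gram lorentz span u | u. hyperbolic_simplex u}"

definition euclidean_grams :: "(real^('m::finite option)^('m option)) set" where
  "euclidean_grams =
     {angle_gram (\<bullet>) (\<lambda>S. affine hull S) u | u :: 'm option \<Rightarrow> real^'m. euclidean_simplex u}"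

text \<open>
  The principal submatrix of \<open>A\<close> with rows and columns in \<open>S\<close> is represented by the pair \<open>S\<close>, \<open>A\<close>.
\<close>

definition det_on :: "'n set \<Rightarrow> real^'n^'n \<Rightarrow> real" where
  "det_on S A = (\<Sum>p | p permutes S. of_int (sign p) * (\<Prod>i\<in>S. A $ i $ p i))"

lemma det_on_UNIV: "det_on UNIV A = det A"
  by (simp add: det_on_def det_def)

text \<open>
  The \<open>(i, j)\<close> entry of the adjugate is the cofactor of position \<open>(j, i)\<close>. As \<open>S\<close> carries no order,
  the signed minor is written as the determinant with row \<open>j\<close> replaced by the \<open>i\<close>-th unit vector.
\<close>

definition adj_on :: "'n set \<Rightarrow> real^'n^'n \<Rightarrow> 'n \<Rightarrow> 'n \<Rightarrow> real" where
  "adj_on S A i j = det_on S (\<chi> r. if r = j then axis i 1 else A $ r)"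

definition psd_on :: "'n set \<Rightarrow> real^'n^'n \<Rightarrow> bool" where
  "psd_on S A \<longleftrightarrow> (\<forall>x :: 'n \<Rightarrow> real. (\<Sum>i\<in>S. \<Sum>j\<in>S. x i * A $ i $ j * x j) \<ge> 0)"

definition diag :: "('n \<Rightarrow> real) \<Rightarrow> real^'n^'n" where
  "diag d = (\<chi> i j. if i = j then d i else 0)"

end

theory Submission
  imports Defs
begin

text \<open>
  Up to positive scaling, the angle Gram matrix of a simplex is the Gram matrix of the basis dual to
  its vertices. Hence a symmetric matrix with unit diagonal is an angle Gram matrix of a spherical
  simplex iff it is positive definite, of a Euclidean one iff it is positive semidefinite with kernel
  spanned by a positive vector, and of a hyperbolic one iff it is positive definite on each
  coordinate hyperplane and its inverse has negative entries only.

  In the limit, compactness of the unit sphere leaves a nonzero nonnegative vector on which the form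
  is not positive; if the limit is semidefinite, this vector lies in the kernel. Conversely, a
  semidefinite matrix with nonnegative kernel vector, and an indefinite one with nonpositive inverse,
  are made to satisfy the strict conditions by explicit small congruences, followed by a rescaling that
  restores the unit diagonal. Euclidean matrices are limits of hyperbolic ones because
  \<open>A - t x x\<^sup>T\<close> is hyperbolic for small \<open>t\<close>, \<open>x\<close> being the positive kernel vector.
\<close>

subsection \<open>Symmetric forms\<close>

text \<open>The three geometries share one computation, carried out for a symmetric involutory
  matrix, the identity or \<open>minkowski\<close>; the Euclidean case merely replaces linear
  coordinates by barycentric ones. Two things can be lost in a limit. The kernel may grow beyond a
  line and its nonnegative vectors may acquire zeros. The adjugate of the whole matrix vanishes once
  the kernel is larger than a line, so the criterion has to pass to a principal submatrix, on the
  support of a suitable kernel vector. The inverse of a hyperbolic matrix may also cease to exist;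
  its sign survives in the adjugate, which is determinant times inverse and polynomial in the
  entries. The determinant, negative on hyperbolic matrices, then separates two cases: if it is zero
  in the limit, semidefiniteness on coordinate hyperplanes spreads to the whole space and the limit
  falls into the Euclidean closure. A singular semidefinite limit of spherical matrices has a kernel
  vector of arbitrary signs, which a diagonal sign matrix makes nonnegative.\<close>

definition form :: "real^'n^'m \<Rightarrow> real^'m \<Rightarrow> real^'n \<Rightarrow> real" where
  "form A x y = x \<bullet> (A *v y)"

lemma form_linear [simp]:
  "form A (x + y) z = form A x z + form A y z"
  "form A x (y' + z') = form A x y' + form A x z'"
  "form A (x - y) z = form A x z - form A y z"
  "form A x (y' - z') = form A x y' - form A x z'"
  "form A (c *\<^sub>R x) z = c * form A x z"
  "form A x (c *\<^sub>R z') = c * form A x z'"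
  "form A 0 z' = 0" "form A x 0 = 0"
  by (simp_all add: form_def inner_add_left inner_diff_left matrix_vector_right_distrib
      matrix_vector_mult_diff_distrib inner_add_right inner_diff_right matrix_vector_mult_scaleR
      mult_minus_right)

lemma form_linear_matrix:
  "form (A + B) x y = form A x y + form B x y"
  "form (A - B) x y = form A x y - form B x y"
  "form (c *\<^sub>R A) x y = c * form A x y"
  by (simp_all add: form_def matrix_vector_mult_add_rdistrib matrix_vector_mult_diff_rdistrib
      inner_add_right inner_diff_right scaleR_matrix_vector_assoc [symmetric])

lemma form_mat_1 [simp]: "form (mat 1) x y = x \<bullet> y"
  by (simp add: form_def)

lemma form_sum:
  "form A (sum f I) y = (\<Sum>i\<in>I. form A (f i) y)"
  "form A x (sum g J) = (\<Sum>i\<in>J. form A x (g i))"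
proof -
  show "form A (sum f I) y = (\<Sum>i\<in>I. form A (f i) y)"
    by (induction I rule: infinite_finite_induct) auto
  show "form A x (sum g J) = (\<Sum>i\<in>J. form A x (g i))"
    by (induction J rule: infinite_finite_induct) auto
qed

lemma form_expand: "form A x y = (\<Sum>i\<in>UNIV. \<Sum>j\<in>UNIV. x$i * A$i$j * y$j)"
  by (simp add: form_def inner_vec_def matrix_vector_mult_def sum_distrib_left ac_simps)

lemma form_axis: "form A (axis i 1) (axis j 1) = A$i$j"
  by (simp add: form_def matrix_vector_mult_basis inner_axis' column_def)

lemma form_transpose: "form (transpose A) x y = form A y x"
  by (simp add: form_def inner_commute[of x] dot_lmul_matrix)

lemma form_matrix_mult: "form (transpose P ** A ** Q) x y = form A (P *v x) (Q *v y)"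
proof -
  have "form (transpose P ** A ** Q) x y = form (transpose P) x (A *v (Q *v y))"
    by (simp add: form_def flip: matrix_vector_mul_assoc)
  then show ?thesis
    by (simp only: form_transpose) (simp add: form_def inner_commute)
qed

lemma form_commute: "transpose A = A \<Longrightarrow> form A x y = form A y x"
  for A :: "real^'n^'n"
  using form_transpose[of A x y] by simp

lemma transpose_eqI: "(\<And>i j. A$i$j = A$j$i) \<Longrightarrow> transpose A = A"
  by (simp add: vec_eq_iff transpose_def)

lemma transpose_nth_eq: "transpose A = A \<Longrightarrow> A$i$j = A$j$i"
  for A :: "real^'n^'n"
  by (metis transpose_def vec_lambda_beta)

text \<open>Along the line \<open>w + c *\<^sub>R x\<close> the form is affine in \<open>c\<close>
  because \<open>x\<close> is isotropic, so a nonzero slope would make it negative somewhere. The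
  subspace \<open>S\<close> serves both for the whole space and for hyperplanes.\<close>

lemma form_zero_imp_orthogonal:
  assumes sym: "transpose A = A" and S: "subspace S" and x: "x \<in> S" and w: "w \<in> S"
    and psd: "\<And>y. y \<in> S \<Longrightarrow> form A y y \<ge> 0" and z: "form A x x = 0"
  shows "form A w x = 0"
proof (rule ccontr)
  assume nz: "form A w x \<noteq> 0"
  \<comment> \<open>This \<open>c\<close> brings the value of the form at
    \<open>w + c *\<^sub>R x\<close> to exactly -1.\<close>
  define c where "c = - (form A w w + 1) / (2 * form A w x)"
  have "w + c *\<^sub>R x \<in> S"
    using S x w by (simp add: subspace_add subspace_scale)
  then have "form A (w + c *\<^sub>R x) (w + c *\<^sub>R x) \<ge> 0"
    by (rule psd)
  moreover have "form A (w + c *\<^sub>R x) (w + c *\<^sub>R x) = form A w w + 2 * (c * form A w x)"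
    using form_commute[OF sym, of w x] z by simp
  moreover have "2 * (c * form A w x) = - (form A w w + 1)"
    using nz by (simp add: c_def)
  ultimately show False by linarith
qed

text \<open>Pairing the isotropic vector \<open>x\<close> with \<open>A *v x\<close> itself gives |A
  x|^2 = 0. This turns a nonpositive direction that survives in a limit into a kernel
  vector.\<close>

lemma psd_form_zero:
  assumes "transpose A = A" "\<And>y. form A y y \<ge> 0" "form A x x \<le> 0"
  shows "A *v x = 0"
proof -
  have "form A (A *v x) x = 0"
    using assms(2)[of x] assms(3)
      form_zero_imp_orthogonal[OF assms(1) subspace_UNIV UNIV_I UNIV_I assms(2), of x "A *v x"]
    by simp
  then show ?thesis by (simp add: form_def)
qed

text \<open>A symmetric form that is semidefinite on a hyperplane has at most one negative direction.\<close>

lemma form_pos_on_orthogonal_complement: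
  assumes sym: "transpose A = A" and nondeg: "\<And>x. A *v x = 0 \<Longrightarrow> x = 0"
    and psd: "\<And>y. a \<bullet> y = 0 \<Longrightarrow> form A y y \<ge> 0"
    and h: "form A h h < 0" and hx: "form A h x = 0" and "x \<noteq> 0"
  shows "form A x x > 0"
proof (rule ccontr)
  assume "\<not> form A x x > 0"
  then have le: "form A x x \<le> 0" by simp
  have ah: "a \<bullet> h \<noteq> 0" using psd[of h] h by auto
  \<comment> \<open>The combination cancels the components along \<open>a\<close>. As
    \<open>h\<close> and \<open>x\<close> are orthogonal, the form on it is a sum of two nonpositive
    terms, which forces \<open>a \<bullet> x = 0\<close>.\<close>
  define z where "z = (a \<bullet> x) *\<^sub>R h - (a \<bullet> h) *\<^sub>R x"
  have "a \<bullet> z = 0" by (simp add: z_def inner_diff_right)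
  then have "form A z z \<ge> 0" by (rule psd)
  moreover have "form A z z = (a \<bullet> x)\<^sup>2 * form A h h + (a \<bullet> h)\<^sup>2 * form A x x"
    using form_commute[OF sym, of x h] hx by (simp add: z_def power2_eq_square)
  moreover have "(a \<bullet> h)\<^sup>2 * form A x x \<le> 0"
    using le by (simp add: mult_nonneg_nonpos)
  ultimately have "(a \<bullet> x)\<^sup>2 * form A h h \<ge> 0" by linarith
  then have ax: "a \<bullet> x = 0" using h by (simp add: zero_le_mult_iff)
  then have xx: "form A x x = 0" using psd[of x] le by simp
  have "A *v x = 0"
  proof -
    \<comment> \<open>By now \<open>x\<close> is an isotropic vector of the hyperplane, hence
      orthogonal to the hyperplane, and it is orthogonal to \<open>h\<close> as well. Shifting
      \<open>y\<close> along \<open>h\<close> into the hyperplane therefore yields |A x|^2 =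
      0.\<close>
    define y where "y = A *v x"
    define c where "c = (a \<bullet> y) / (a \<bullet> h)"
    have "a \<bullet> (y - c *\<^sub>R h) = 0" using ah by (simp add: c_def inner_diff_right)
    then have "form A (y - c *\<^sub>R h) x = 0"
      using ax psd xx form_zero_imp_orthogonal[OF sym subspace_hyperplane[of a], of x "y - c *\<^sub>R h"]
      by simp
    then have "form A y x = 0" using hx by simp
    then show ?thesis by (simp add: y_def form_def)
  qed
  then show False using nondeg \<open>x \<noteq> 0\<close> by blast
qed

text \<open>Gram-Schmidt for the form on \<open>S\<close>: as long as fewer than
  \<open>dim S\<close> vectors are chosen, some vector of \<open>S\<close> lies outside their span,
  and what remains after subtracting its components is nonzero, hence of positive square.\<close>

lemma orthonormal_family_exists:
  fixes A :: "real^'n^'n"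
  assumes sym: "transpose A = A" and S: "subspace S"
    and pd: "\<And>y. y \<in> S \<Longrightarrow> y \<noteq> 0 \<Longrightarrow> form A y y > 0"
    and "finite K" "card K \<le> dim S"
  shows "\<exists>f. \<forall>i\<in>K. f i \<in> S \<and> (\<forall>j\<in>K. form A (f i) (f j) = (if i = j then 1 else 0))"
  using \<open>finite K\<close> \<open>card K \<le> dim S\<close>
proof (induction K rule: finite_induct)
  case empty
  then show ?case by simp
next
  case (insert k K)
  then obtain f where f: "\<And>i. i \<in> K \<Longrightarrow> f i \<in> S"
      "\<And>i j. i \<in> K \<Longrightarrow> j \<in> K \<Longrightarrow> form A (f i) (f j) = (if i = j then 1 else 0)"
    by auto
  have "dim (f ` K) \<le> card K"
    by (meson card_image_le dim_le_card' finite_imageI insert.hyps(1) le_trans)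
  also have "\<dots> < dim S" using insert by simp
  finally have "\<not> S \<subseteq> span (f ` K)"
    by (metis dim_subset dim_span leD)
  then obtain x where x: "x \<in> S" "x \<notin> span (f ` K)" by blast
  define y where "y = x - (\<Sum>i\<in>K. form A (f i) x *\<^sub>R f i)"
  have yS: "y \<in> S" unfolding y_def
    using S x f by (intro subspace_diff subspace_sum subspace_scale) auto
  have "y \<noteq> 0"
  proof
    assume "y = 0"
    then have "x = (\<Sum>i\<in>K. form A (f i) x *\<^sub>R f i)" by (simp add: y_def)
    also have "\<dots> \<in> span (f ` K)" by (intro span_sum span_scale span_base) auto
    finally show False using x by simp
  qed
  then have pos: "form A y y > 0" using pd yS by blast
  have orth: "form A (f j) y = 0" if "j \<in> K" for j
  proof -
    have "form A (f j) y = form A (f j) x - (\<Sum>i\<in>K. form A (f i) x * (if j = i then 1 else 0))"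
      using f(2)[OF that] by (simp add: y_def form_sum)
    also have "\<dots> = 0"
      using insert(1) that by (simp add: if_distrib sum.delta cong: if_cong)
    finally show ?thesis .
  qed
  define g where "g = (\<lambda>i. if i = k then (1 / sqrt (form A y y)) *\<^sub>R y else f i)"
  have "g i \<in> S" if "i \<in> insert k K" for i
    using that f(1) yS S by (auto simp: g_def subspace_scale)
  moreover have "form A (g i) (g j) = (if i = j then 1 else 0)"
    if "i \<in> insert k K" "j \<in> insert k K" for i j
  proof -
    have "form A (g k) (g k) = form A y y / (sqrt (form A y y) * sqrt (form A y y))"
      by (simp add: g_def)
    then have "form A (g k) (g k) = 1" using pos by simp
    moreover have "form A (g k) (g j) = 0 \<and> form A (g j) (g k) = 0" if "j \<in> K" for j
      using orth[OF that] form_commute[OF sym, of y "f j"] that insert.hyps(2) by (auto simp: g_def)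
    moreover have "form A (g i) (g j) = form A (f i) (f j)" if "i \<in> K" "j \<in> K" for i j
      using that insert.hyps(2) by (auto simp: g_def)
    ultimately show ?thesis
      using that f(2) insert.hyps(2) by auto
  qed
  ultimately show ?case by blast
qed

text \<open>Up to sign and normalisation, \<open>H\<close> is the Gram matrix of the vertices dual to the normals.\<close>

definition hyperbolic_form :: "real^'n^'n \<Rightarrow> bool" where
  "hyperbolic_form G \<longleftrightarrow> transpose G = G \<and> (\<exists>H. G ** H = mat 1 \<and> (\<forall>i j. H$i$j < 0)) \<and>
     (\<forall>i x. x$i = 0 \<longrightarrow> x \<noteq> 0 \<longrightarrow> form G x x > 0)"

text \<open>Like its two companions, the notion omits the unit diagonal, so that it is invariant
  under positive diagonal congruence; \<open>unit_diag\<close> supplies the normalisation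
  afterwards.\<close>

definition spherical_form :: "real^'n^'n \<Rightarrow> bool" where
  "spherical_form G \<longleftrightarrow> transpose G = G \<and> (\<forall>x. x \<noteq> 0 \<longrightarrow> form G x x > 0)"

definition euclidean_form :: "real^'n^'n \<Rightarrow> bool" where
  "euclidean_form G \<longleftrightarrow> transpose G = G \<and> (\<forall>y. form G y y \<ge> 0) \<and>
     (\<exists>x. (\<forall>i. x$i > 0) \<and> G *v x = 0 \<and> (\<forall>y. form G y y = 0 \<longrightarrow> (\<exists>c. y = c *\<^sub>R x)))"

lemma right_inverse_imp_nondegenerate:
  fixes G :: "real^'n^'n"
  assumes "G ** H = mat 1" "G *v x = 0"
  shows "x = 0"
proof -
  have "H ** G = mat 1" using assms(1) matrix_left_right_inverse by blast
  then have "x = H *v (G *v x)" by (simp add: matrix_vector_mul_assoc)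
  then show ?thesis using assms(2) by simp
qed

text \<open>The \<open>i\<close>-th column \<open>h\<close> of \<open>H\<close> satisfies G h = e_i,
  so \<open>h\<close> is a negative direction whose orthogonal complement is the coordinate
  hyperplane x_i = 0. Semidefiniteness on any single hyperplane, which is easy to check in each
  construction, then makes the form definite on all coordinate hyperplanes.\<close>

lemma hyperbolic_formI:
  fixes G :: "real^'n^'n"
  assumes sym: "transpose G = G" and inv: "G ** H = mat 1" and neg: "\<And>i j. H$i$j < 0"
    and psd: "\<And>y. a \<bullet> y = 0 \<Longrightarrow> form G y y \<ge> 0"
  shows "hyperbolic_form G"
proof -
  have "form G x x > 0" if "x$i = 0" "x \<noteq> 0" for i x
  proof (rule form_pos_on_orthogonal_complement[OF sym _ psd])
    define h where "h = H *v axis i 1"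
    have Gh: "G *v h = axis i 1" by (simp add: h_def matrix_vector_mul_assoc inv)
    then have "form G h h = H$i$i"
      by (simp add: form_def inner_axis) (simp add: h_def matrix_vector_mult_basis column_def)
    then show "form G h h < 0" using neg by simp
    show "form G h x = 0"
      using Gh that by (simp add: form_commute[OF sym, of h x]) (simp add: form_def inner_axis)
  qed (use that right_inverse_imp_nondegenerate[OF inv] in auto)
  then show ?thesis using assms by (auto simp: hyperbolic_form_def)
qed

subsection \<open>Dihedral angles and normals\<close>

definition diag_scale :: "('n \<Rightarrow> real) \<Rightarrow> real^'n^'n \<Rightarrow> real^'n^'n" where
  "diag_scale d G = (\<chi> i j. d i * d j * G$i$j)"

definition unit_diag :: "real^'n^'n \<Rightarrow> real^'n^'n" where
  "unit_diag G = (\<chi> i j. G$i$j / (sqrt (G$i$i) * sqrt (G$j$j)))"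

definition gram :: "real^'m^'m \<Rightarrow> ('n \<Rightarrow> real^'m) \<Rightarrow> real^'n^'n" where
  "gram B w = (\<chi> i j. form B (w i) (w j))"

text \<open>Within the span of \<open>v\<close> and \<open>w\<close>, \<open>N\<close> is the vector
  with \<open>form B v N = 0\<close> and \<open>form B w N = 1\<close>, so \<open>u - N\<close> lies
  in \<open>L\<close> and \<open>N\<close> is perpendicular to the directions of \<open>L\<close>.
  For uniqueness, \<open>D \<noteq> 0\<close> means that \<open>v\<close>, \<open>w\<close> and
  these directions span the whole space, so the difference \<open>d\<close> of two feet is
  orthogonal to everything.\<close>

lemma foot_eq:
  fixes B :: "real^'n^'n"
  assumes sym: "transpose B = B" and nondeg: "\<And>x. B *v x = 0 \<Longrightarrow> x = 0"
    and L: "L = {y. form B v y = a \<and> form B w y = b}"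
    and u: "form B v u = a" "form B w u = b + 1"
    and De: "D = form B v v * form B w w - (form B v w)\<^sup>2" and D: "D \<noteq> 0"
    and N: "N = (1 / D) *\<^sub>R (form B v v *\<^sub>R w - form B v w *\<^sub>R v)"
  shows "foot (form B) L u = u - N"
proof -
  have wv: "form B w v = form B v w" by (rule form_commute[OF sym])
  have vN: "form B v N = 0" by (simp add: N wv)
  have wN: "form B w N = 1"
  proof -
    have "form B w N = D / D" by (simp add: N wv De power2_eq_square)
    then show ?thesis using D by simp
  qed
  show ?thesis
    unfolding foot_def
  proof (rule the_equality, intro conjI ballI)
    show inL: "u - N \<in> L" by (simp add: L u vN wN)
    show "form B (u - (u - N)) (y - (u - N)) = 0" if "y \<in> L" for y
    proof -
      have "form B v (y - (u - N)) = 0" "form B w (y - (u - N)) = 0"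
        using that inL by (simp_all add: L)
      moreover have "form B N z = (1 / D) * (form B v v * form B w z - form B v w * form B v z)" for z
        by (simp add: N)
      ultimately have "form B N (y - (u - N)) = 0" by (simp only:) simp
      then show ?thesis by simp
    qed
    fix q assume q: "q \<in> L \<and> (\<forall>y\<in>L. form B (u - q) (y - q) = 0)"
    define d where "d = u - N - q"
    have vd: "form B v d = 0" and wd: "form B w d = 0"
      using q inL by (simp_all add: L d_def)
    have orth: "form B d z = 0" if "form B v z = 0" "form B w z = 0" for z
    proof -
      have "q + z \<in> L" using q that by (simp add: L)
      then have "form B (u - q) z = 0" using q by force
      moreover have "form B N z = 0" using that by (simp add: N)
      ultimately show ?thesis by (simp add: d_def)
    qed
    have "form B d z = 0" for z
    proof -
      \<comment> \<open>Cramer's rule for the 2x2 system of determinant \<open>D\<close> which says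
        that subtracting \<alpha> v + \<beta> w makes \<open>z\<close> orthogonal to both
        \<open>v\<close> and \<open>w\<close>.\<close>
      define \<alpha> where "\<alpha> = (form B w w * form B v z - form B v w * form B w z) / D"
      define \<beta> where "\<beta> = (form B v v * form B w z - form B v w * form B v z) / D"
      have "\<alpha> * form B v v + \<beta> * form B v w = form B v z * D / D"
        by (simp add: \<alpha>_def \<beta>_def De add_divide_distrib [symmetric] algebra_simps power2_eq_square)
      moreover have "\<alpha> * form B v w + \<beta> * form B w w = form B w z * D / D"
        by (simp add: \<alpha>_def \<beta>_def De add_divide_distrib [symmetric] algebra_simps power2_eq_square)
      ultimately have "form B d (z - \<alpha> *\<^sub>R v - \<beta> *\<^sub>R w) = 0"
        using D by (intro orth) (simp_all add: wv)
      then show ?thesis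
        using vd wd form_commute[OF sym, of d] by simp
    qed
    then have "form B (B *v d) d = 0" using form_commute[OF sym] by metis
    then have "d = 0" using nondeg by (simp add: form_def)
    then show "q = u - N" by (simp add: d_def)
  qed
qed

text \<open>The vectors \<open>M\<close> and \<open>N\<close> are the basis dual to
  \<open>v\<close>, \<open>w\<close> in their common plane, so their Gram matrix is the inverse of
  the 2x2 Gram matrix of \<open>v\<close> and \<open>w\<close>. Inversion flips the sign of the
  off-diagonal entry, which cancels the minus sign in front of the cosine.\<close>

lemma cos_form_angle:
  assumes sym: "transpose B = B"
    and pos: "form B v v > 0" "form B w w > 0"
    and De: "D = form B v v * form B w w - (form B v w)\<^sup>2" and D: "D > 0"
    and N: "N = (1 / D) *\<^sub>R (form B v v *\<^sub>R w - form B v w *\<^sub>R v)"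
    and M: "M = (1 / D) *\<^sub>R (form B w w *\<^sub>R v - form B v w *\<^sub>R w)"
  shows "- cos (form_angle (form B) N M) = form B v w / (sqrt (form B v v) * sqrt (form B w w))"
proof -
  define a b c where abc: "a = form B v v" "b = form B w w" "c = form B v w"
  have wv: "form B w v = c" by (simp add: abc form_commute[OF sym])
  have D': "a * b - c\<^sup>2 > 0" using D by (simp add: abc De)
  have "form B N N = (1 / D)\<^sup>2 * (a * (a * b - c\<^sup>2))"
    unfolding N using D
    by (simp add: wv flip: abc) (simp add: field_simps power2_eq_square)
  then have NN: "form B N N = a / (a * b - c\<^sup>2)"
    using D' by (simp add: De power2_eq_square flip: abc)
  have "form B M M = (1 / D)\<^sup>2 * (b * (a * b - c\<^sup>2))"
    unfolding M using D
    by (simp add: wv flip: abc) (simp add: field_simps power2_eq_square)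
  then have MM: "form B M M = b / (a * b - c\<^sup>2)"
    using D' by (simp add: De power2_eq_square flip: abc)
  have "form B N M = (1 / D)\<^sup>2 * (- c * (a * b - c\<^sup>2))"
    unfolding N M using D
    by (simp add: wv flip: abc) (simp add: field_simps power2_eq_square)
  then have NM: "form B N M = - c / (a * b - c\<^sup>2)"
    using D' by (simp add: De power2_eq_square flip: abc)
  have ab: "a > 0" "b > 0" using pos by (simp_all add: abc)
  have "sqrt (a / (a * b - c\<^sup>2)) * sqrt (b / (a * b - c\<^sup>2)) = sqrt a * sqrt b / (a * b - c\<^sup>2)"
    using D' by (simp add: real_sqrt_divide)
  then have q: "form B N M / (sqrt (form B N N) * sqrt (form B M M)) = - (c / (sqrt a * sqrt b))"
    using D' by (simp add: NN MM NM)
  \<comment> \<open>Positivity of \<open>D\<close> is the Cauchy-Schwarz inequality here; it keeps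
    the quotient in the range where \<open>cos\<close> undoes \<open>arccos\<close>.\<close>
  have "\<bar>c\<bar> \<le> sqrt a * sqrt b"
    using D' by (simp add: real_le_rsqrt flip: real_sqrt_mult)
  then have "\<bar>c / (sqrt a * sqrt b)\<bar> \<le> 1"
    using ab by (simp add: abs_mult)
  then have "cos (arccos (- (c / (sqrt a * sqrt b)))) = - (c / (sqrt a * sqrt b))"
    by (intro cos_arccos_abs) simp
  then show ?thesis
    unfolding form_angle_def q by (simp add: abc)
qed

lemma diag_pos_if_minors_pos:
  fixes G :: "real^'n^'n"
  assumes "CARD('n) \<ge> 3" and pos: "\<And>i x. x$i = 0 \<Longrightarrow> x \<noteq> 0 \<Longrightarrow> form G x x > 0"
  shows "G$i$i > 0"
proof -
  have "(UNIV :: 'n set) \<noteq> {i}"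
  proof
    assume "(UNIV :: 'n set) = {i}"
    then have "CARD('n) = card {i}" by (rule arg_cong)
    then show False using assms(1) by simp
  qed
  then obtain k where "i \<noteq> k" by (metis UNIV_eq_I singletonI)
  then have "form G (axis i 1) (axis i 1) > 0"
    by (intro pos[of _ k]) (auto simp: axis_def vec_eq_iff)
  then show ?thesis by (simp add: form_axis)
qed

text \<open>This is where dimension at least 2 enters: a third index \<open>k\<close> exists, so
  vectors supported on \<open>i\<close> and \<open>j\<close> lie in a coordinate hyperplane, where
  the form is positive.\<close>

lemma minor_2x2_pos:
  fixes G :: "real^'n^'n"
  assumes card: "CARD('n) \<ge> 3" and sym: "transpose G = G"
    and pos: "\<And>i x. x$i = 0 \<Longrightarrow> x \<noteq> 0 \<Longrightarrow> form G x x > 0"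
    and "i \<noteq> j"
  shows "G$i$i > 0" "G$i$i * G$j$j - (G$i$j)\<^sup>2 > 0"
proof -
  have "(UNIV :: 'n set) - {i, j} \<noteq> {}"
  proof
    assume "(UNIV :: 'n set) - {i, j} = {}"
    then have "card (UNIV :: 'n set) \<le> card {i, j}" by (intro card_mono) auto
    then show False using card \<open>i \<noteq> j\<close> by simp
  qed
  then obtain k where k: "k \<noteq> i" "k \<noteq> j" by auto
  show ii: "G$i$i > 0" by (rule diag_pos_if_minors_pos[OF card pos])
  \<comment> \<open>Up to scaling, the vector in the plane of the two axes that is orthogonal to the
    \<open>i\<close>-th axis with respect to \<open>G\<close>.\<close>
  define x :: "real^'n" where "x = G$i$j *\<^sub>R axis i 1 - G$i$i *\<^sub>R axis j 1"
  have "form G x x > 0"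
  proof (rule pos)
    show "x$k = 0" using k by (simp add: x_def axis_def)
    have "x$j \<noteq> 0" using \<open>i \<noteq> j\<close> ii by (simp add: x_def axis_def)
    then show "x \<noteq> 0" by auto
  qed
  moreover have "form G x x = G$i$i * (G$i$i * G$j$j - (G$i$j)\<^sup>2)"
    using transpose_nth_eq[OF sym, of j i]
    by (simp add: x_def form_axis algebra_simps power2_eq_square)
  ultimately show "G$i$i * G$j$j - (G$i$j)\<^sup>2 > 0"
    using ii by (simp add: zero_less_mult_iff)
qed

text \<open>
  The \<open>y \<mapsto> form B (w i) y - c i\<close> are the coordinates of \<open>y\<close> with respect to the vertices: linear
  ones (\<open>c = 0\<close>) in the spherical and hyperbolic case, barycentric ones in the Euclidean case.
\<close>

lemma angle_gram_eq_unit_diag: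
  fixes B :: "real^'m^'m" and u w :: "'n::finite \<Rightarrow> real^'m"
  assumes card: "CARD('n) \<ge> 3" and sym: "transpose B = B" and nondeg: "\<And>x. B *v x = 0 \<Longrightarrow> x = 0"
    and hull: "\<And>i j. i \<noteq> j \<Longrightarrow> hl (u ` (- {i, j})) = {y. form B (w i) y = c i \<and> form B (w j) y = c j}"
    and dual: "\<And>i j. form B (w i) (u j) = c i + (if i = j then 1 else 0)"
    and pos: "\<And>i x. x$i = 0 \<Longrightarrow> x \<noteq> 0 \<Longrightarrow> form (gram B w) x x > 0"
  shows "angle_gram (form B) hl u = unit_diag (gram B w)"
proof -
  define G where "G = gram B w"
  have Gij: "G$i$j = form B (w i) (w j)" for i j by (simp add: G_def gram_def)
  have symG: "transpose G = G"
    by (rule transpose_eqI) (simp add: Gij form_commute[OF sym])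
  have minors: "G$i$i > 0" "G$i$i * G$j$j - (G$i$j)\<^sup>2 > 0" if "i \<noteq> j" for i j
    using minor_2x2_pos[OF card symG _ that] pos unfolding G_def by blast+
  have "angle_gram (form B) hl u $ i $ j = unit_diag G $ i $ j" for i j
  proof (cases "i = j")
    case True
    have "G$i$i > 0"
      unfolding G_def by (rule diag_pos_if_minors_pos[OF card pos])
    then show ?thesis
      using True by (simp add: angle_gram_def dihedral_angle_def unit_diag_def)
  next
    case False
    \<comment> \<open>The components of \<open>u j\<close> and \<open>u i\<close> perpendicular to
      the codimension-2 face, written in terms of its normals \<open>w i\<close> and
      \<open>w j\<close>: \<open>N\<close> belongs to \<open>u j\<close> and \<open>M\<close> to
      \<open>u i\<close>.\<close>
    define N where "N = (1 / (G$i$i * G$j$j - (G$i$j)\<^sup>2)) *\<^sub>R (G$i$i *\<^sub>R w j - G$i$j *\<^sub>R w i)"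
    define M where "M = (1 / (G$i$i * G$j$j - (G$i$j)\<^sup>2)) *\<^sub>R (G$j$j *\<^sub>R w i - G$i$j *\<^sub>R w j)"
    define L where "L = hl (u ` (- {i, j}))"
    have D: "G$i$i > 0" "G$j$j > 0" "G$i$i * G$j$j - (G$i$j)\<^sup>2 > 0"
      using minors[of i j] minors[of j i] False by auto
    have "foot (form B) L (u j) = u j - N"
      by (rule foot_eq[OF sym, of _ "w i" "c i" "w j" "c j" _ _ N, OF _ _ _ _ refl])
         (use nondeg D False in \<open>auto simp: L_def hull dual N_def Gij\<close>)
    moreover have "foot (form B) L (u i) = u i - M"
      by (rule foot_eq[OF sym, of _ "w j" "c j" "w i" "c i" _ _ M, OF _ _ _ _ refl])
         (use nondeg D False in \<open>auto simp: L_def hull dual M_def Gij form_commute[OF sym, of "w j" "w i"] mult.commute\<close>)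
    ultimately have "dihedral_angle (form B) hl u i j = form_angle (form B) N M"
      using False by (simp add: dihedral_angle_def Let_def L_def)
    then show ?thesis
      using cos_form_angle[OF sym _ _ refl, of "w i" "w j" N M] D
      by (simp add: angle_gram_def unit_diag_def Gij N_def M_def)
  qed
  then show ?thesis by (simp add: vec_eq_iff G_def)
qed

section \<open>Dual bases and their Gram matrices\<close>

lemma form_gram:
  "form (gram B w) x y = form B (\<Sum>i\<in>UNIV. x$i *\<^sub>R w i) (\<Sum>i\<in>UNIV. y$i *\<^sub>R w i)"
  unfolding form_sum form_expand[of "gram B w"]
  by (simp add: gram_def ac_simps, rule sum.swap)

lemma transpose_gram: "transpose B = B \<Longrightarrow> transpose (gram B w) = gram B w"
  by (rule transpose_eqI) (simp add: gram_def form_commute)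

lemma axis_vector_matrix_mult: "axis i 1 v* W = W$i"
  for W :: "real^'n^'m"
  by (simp add: matrix_vector_mult_basis column_transpose row_def vec_eq_iff flip: transpose_matrix_vector)

lemma matrix_mult_nth_eq_form: "(W ** B ** transpose U)$i$j = form B (W$i) (U$j)"
  using form_matrix_mult[of "transpose W" B "transpose U" "axis i 1" "axis j 1"]
  by (simp add: form_axis axis_vector_matrix_mult)

text \<open>Duality says M N = 1, where \<open>M\<close> reads off coordinates and \<open>N\<close>
  forms combinations of the \<open>u k\<close>. There are as many vectors as dimensions, so the
  matrices are square and N M = 1, which is the expansion.\<close>

lemma dual_expand:
  fixes B :: "real^'n^'n" and u w :: "'n \<Rightarrow> real^'n"
  assumes dual: "\<And>i j. form B (w i) (u j) = (if i = j then 1 else 0)"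
  shows "(\<Sum>k\<in>UNIV. form B (w k) y *\<^sub>R u k) = y"
proof -
  define M where "M = (\<chi> k. w k v* B)"
  define N where "N = (\<chi> l k. u k $ l)"
  have M: "(M *v z)$k = form B (w k) z" for z k
    by (simp add: M_def matrix_vector_mul_component dot_lmul_matrix form_def)
  have N: "N *v z = (\<Sum>k\<in>UNIV. z$k *\<^sub>R u k)" for z
    by (simp add: vec_eq_iff N_def matrix_vector_mult_def mult.commute)
  have "M *v (N *v z) = z" for z
    by (simp add: vec_eq_iff M N form_sum dual if_distrib sum.delta' cong: if_cong)
  then have "M ** N = mat 1"
    by (simp add: matrix_eq flip: matrix_vector_mul_assoc)
  then have "N ** M = mat 1" by (simp add: matrix_left_right_inverse)
  then have "N *v (M *v y) = y" by (simp add: matrix_vector_mul_assoc)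
  then show ?thesis by (simp add: N M)
qed

lemma dual_imp_inj: "(\<And>i j. form B (w i) (u j) = c i + (if i = j then 1 else 0)) \<Longrightarrow> inj u"
  by (rule injI) (metis add_cancel_left_right zero_neq_one)

lemma dual_imp_independent:
  assumes dual: "\<And>i j. form B (w i) (u j) = (if i = j then 1 else 0)"
  shows "independent (range u)"
proof
  assume "dependent (range u)"
  then obtain i where i: "u i \<in> span (range u - {u i})" by (auto simp: dependent_def)
  have "span (range u - {u i}) \<subseteq> {y. form B (w i) y = 0}"
    by (rule span_minimal) (auto simp: dual subspace_def)
  then show False using i dual[of i i] by auto
qed

text \<open>The columns of a right inverse of the matrix with rows \<open>u i\<close> are dual to
  the \<open>u i\<close> for the dot product; applying the involution \<open>B\<close> turns this
  into duality for \<open>B\<close>.\<close>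

lemma independent_imp_dual_exists:
  fixes B :: "real^'n^'n" and u :: "'n \<Rightarrow> real^'n"
  assumes inj: "inj u" and ind: "independent (range u)"
    and sym: "transpose B = B" and inv: "B ** B = mat 1"
  shows "\<exists>w. \<forall>i j. form B (w i) (u j) = (if i = j then 1 else 0)"
proof -
  have "c i = 0" if "(\<Sum>i\<in>UNIV. c i *\<^sub>R u i) = 0" for c i
  proof -
    have "(\<Sum>v\<in>range u. c (inv u v) *\<^sub>R v) = 0"
      using that inj by (simp add: sum.reindex)
    then have "c (inv u (u i)) = 0"
      by (rule independentD[OF ind, of "range u" "\<lambda>v. c (inv u v)", rotated 2]) auto
    then show ?thesis using inj by simp
  qed
  then have "\<exists>V. (\<chi> i. u i) ** V = mat 1"
    unfolding matrix_right_invertible_independent_rows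
    by (simp add: row_def scalar_mult_eq_scaleR)
  then obtain V where V: "(\<chi> i. u i) ** V = mat 1" by blast
  define w where "w = (\<lambda>i. B *v column i V)"
  have "form B (w i) (u j) = (if i = j then 1 else 0)" for i j
  proof -
    have "form B (w i) (u j) = u j \<bullet> (B *v (B *v column i V))"
      by (simp add: form_commute[OF sym, of "w i"]) (simp add: form_def w_def)
    also have "\<dots> = u j \<bullet> column i V"
      by (simp add: matrix_vector_mul_assoc inv)
    also have "\<dots> = ((\<chi> i. u i) ** V)$j$i"
      by (simp add: inner_vec_def matrix_matrix_mult_def column_def)
    finally show ?thesis by (simp add: V mat_def)
  qed
  then show ?thesis by blast
qed

lemma span_eq_dual_kernel:
  fixes B :: "real^'n^'n" and u w :: "'n \<Rightarrow> real^'n"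
  assumes dual: "\<And>i j. form B (w i) (u j) = (if i = j then 1 else 0)"
  shows "span (u ` (- {i, j})) = {y. form B (w i) y = 0 \<and> form B (w j) y = 0}"
proof
  show "span (u ` (- {i, j})) \<subseteq> {y. form B (w i) y = 0 \<and> form B (w j) y = 0}"
    by (rule span_minimal) (auto simp: dual subspace_def)
  show "{y. form B (w i) y = 0 \<and> form B (w j) y = 0} \<subseteq> span (u ` (- {i, j}))"
  proof
    fix y assume y: "y \<in> {y. form B (w i) y = 0 \<and> form B (w j) y = 0}"
    have "y = (\<Sum>k\<in>UNIV. form B (w k) y *\<^sub>R u k)" by (simp add: dual_expand[OF dual])
    also have "\<dots> = (\<Sum>k\<in>- {i, j}. form B (w k) y *\<^sub>R u k)"
      by (rule sum.mono_neutral_right) (use y in auto)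
    also have "\<dots> \<in> span (u ` (- {i, j}))"
      by (intro span_sum span_scale span_base) auto
    finally show "y \<in> span (u ` (- {i, j}))" .
  qed
qed

lemma involution_nondegenerate: "B ** B = mat 1 \<Longrightarrow> B *v x = 0 \<Longrightarrow> x = 0"
  for B :: "real^'n^'n"
  by (rule right_inverse_imp_nondegenerate)

text \<open>The coefficients of \<open>w i\<close> in the basis \<open>u\<close> are the entries of
  \<open>gram B w\<close>; pairing this expansion with \<open>u j\<close> gives the product of the
  two Gram matrices.\<close>

lemma gram_dual_inverse:
  fixes B :: "real^'n^'n" and u w :: "'n \<Rightarrow> real^'n"
  assumes dual: "\<And>i j. form B (w i) (u j) = (if i = j then 1 else 0)" and sym: "transpose B = B"
  shows "gram B w ** gram B u = mat 1"
proof -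
  have "(\<Sum>k\<in>UNIV. form B (w i) (w k) * form B (u k) (u j)) = form B (w i) (u j)" for i j
  proof -
    have "form B (w i) (u j) = form B (\<Sum>k\<in>UNIV. form B (w k) (w i) *\<^sub>R u k) (u j)"
      by (simp only: dual_expand[OF dual])
    then show ?thesis by (simp add: form_sum form_commute[OF sym, of "w i"])
  qed
  then show ?thesis
    by (simp add: vec_eq_iff matrix_matrix_mult_def gram_def mat_def dual)
qed

text \<open>With \<open>F\<close> the matrix of rows \<open>f i\<close>, the hypothesis reads F G
  F^T = B. As \<open>B\<close> is its own inverse, \<open>W\<close> is the inverse of
  \<open>F\<close>, whence W B W^T = G: the rows of \<open>W\<close> are the normals. The rows of
  \<open>U\<close> are dual to them because W B U^T = W F = 1.\<close>

lemma congruent_realisation: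
  fixes G B :: "real^'n^'n"
  assumes sym: "transpose G = G" and symB: "transpose B = B" and inv: "B ** B = mat 1"
    and f: "\<And>i j. form G (f i) (f j) = B$i$j"
  shows "\<exists>u w. gram B w = G \<and> (\<forall>i j. form B (w i) (u j) = (if i = j then 1 else 0))"
proof -
  define F where "F = (\<chi> i. f i)"
  have FGF: "F ** G ** transpose F = B"
    by (simp add: vec_eq_iff matrix_mult_nth_eq_form f F_def)
  define W where "W = G ** transpose F ** B"
  define U where "U = transpose F ** B"
  have "F ** (G ** transpose F ** B) = mat 1"
    using FGF inv by (simp add: matrix_mul_assoc)
  then have WF: "G ** transpose F ** B ** F = mat 1"
    using matrix_left_right_inverse by blast
  have "W ** B ** transpose W = G ** transpose F ** (B ** B) ** B ** F ** G"
    by (simp add: W_def matrix_transpose_mul sym symB matrix_mul_assoc)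
  also have "\<dots> = (G ** transpose F ** B ** F) ** G" by (simp add: inv)
  finally have "W ** B ** transpose W = G" by (simp add: WF)
  moreover have "W ** B ** transpose U = G ** transpose F ** (B ** B) ** B ** F"
    by (simp add: W_def U_def matrix_transpose_mul symB matrix_mul_assoc)
  then have "W ** B ** transpose U = mat 1" by (simp add: inv WF)
  ultimately have "form B (W$i) (W$j) = G$i$j" "form B (W$i) (U$j) = mat 1$i$j" for i j
    by (simp_all flip: matrix_mult_nth_eq_form)
  then have "gram B (\<lambda>i. W$i) = G" "\<And>i j. form B (W$i) (U$j) = (if i = j then 1 else 0)"
    by (simp_all add: gram_def vec_eq_iff mat_def)
  then show ?thesis by blast
qed

section \<open>Positive diagonal rescaling\<close>

lemma form_diag_scale: "form (diag_scale d G) x y = form G (\<chi> i. d i * x$i) (\<chi> i. d i * y$i)"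
  by (simp add: form_expand diag_scale_def ac_simps)

lemma transpose_diag_scale: "transpose G = G \<Longrightarrow> transpose (diag_scale d G) = diag_scale d G"
  by (rule transpose_eqI) (simp add: diag_scale_def transpose_nth_eq[of G] mult.commute)

lemma unit_diag_eq_diag_scale: "unit_diag G = diag_scale (\<lambda>i. 1 / sqrt (G$i$i)) G"
  by (simp add: unit_diag_def diag_scale_def vec_eq_iff)

lemma unit_diag_diag_scale: "(\<And>i. d i > 0) \<Longrightarrow> unit_diag (diag_scale d G) = unit_diag G"
  by (simp add: unit_diag_def diag_scale_def vec_eq_iff real_sqrt_mult abs_of_pos less_imp_le)
     (metis less_irrefl)

lemma unit_diag_id: "(\<And>i. G$i$i = 1) \<Longrightarrow> unit_diag G = G"
  by (simp add: unit_diag_def vec_eq_iff)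

lemma spherical_form_diag_scale:
  assumes d: "\<And>i. d i > 0" and G: "spherical_form G"
  shows "spherical_form (diag_scale d G)"
proof -
  have "(\<chi> i. d i * x$i) \<noteq> 0" if "x \<noteq> 0" for x
    using d that by (auto simp: vec_eq_iff) (metis less_irrefl)
  then show ?thesis
    using G by (simp add: spherical_form_def form_diag_scale transpose_diag_scale)
qed

lemma euclidean_form_diag_scale:
  assumes d: "\<And>i. d i > 0" and G: "euclidean_form G"
  shows "euclidean_form (diag_scale d G)"
proof -
  obtain x where x: "\<And>i. x$i > 0" "G *v x = 0" "\<And>y. form G y y = 0 \<Longrightarrow> \<exists>c. y = c *\<^sub>R x"
    and psd: "\<And>y. form G y y \<ge> 0" and sym: "transpose G = G"
    using G by (auto simp: euclidean_form_def)
  have nz: "d i \<noteq> 0" for i using d[of i] by simp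
  \<comment> \<open>The kernel transforms by the inverse scaling and so stays positive.\<close>
  define z where "z = (\<chi> i. x$i / d i)"
  have dz: "(\<chi> i. d i * z$i) = x" by (simp add: z_def vec_eq_iff nz)
  have psd': "form (diag_scale d G) y y \<ge> 0" for y using psd by (simp add: form_diag_scale)
  have "diag_scale d G *v z = 0"
    using sym x(2) by (intro psd_form_zero psd') (simp_all add: transpose_diag_scale form_diag_scale dz form_def[of G])
  moreover have "\<exists>c. y = c *\<^sub>R z" if y0: "form (diag_scale d G) y y = 0" for y
  proof -
    obtain c where "(\<chi> i. d i * y$i) = c *\<^sub>R x" using y0 x(3) by (auto simp: form_diag_scale)
    then have "d i * y$i = c * x$i" for i by (simp add: vec_eq_iff)
    then have "y = c *\<^sub>R z" using nz by (simp add: vec_eq_iff z_def field_simps)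
    then show ?thesis by blast
  qed
  moreover have "z$i > 0" for i using d x by (simp add: z_def)
  ultimately show ?thesis
    using sym psd' by (auto simp: euclidean_form_def transpose_diag_scale)
qed

lemma hyperbolic_form_diag_scale:
  assumes d: "\<And>i. d i > 0" and G: "hyperbolic_form G"
  shows "hyperbolic_form (diag_scale d G)"
proof -
  obtain H where H: "G ** H = mat 1" "\<And>i j. H$i$j < 0"
    using G by (auto simp: hyperbolic_form_def)
  have nz: "d i \<noteq> 0" for i using d[of i] by simp
  have "(\<Sum>k\<in>UNIV. G$i$k * H$k$j) = (if i = j then 1 else 0)" for i j
    using H(1) by (simp add: vec_eq_iff matrix_matrix_mult_def mat_def)
  then have "diag_scale d G ** diag_scale (\<lambda>i. 1 / d i) H = mat 1"
    using nz by (simp add: vec_eq_iff matrix_matrix_mult_def mat_def diag_scale_def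
        flip: sum_distrib_left sum_divide_distrib)
  moreover have "diag_scale (\<lambda>i. 1 / d i) H $ i $ j < 0" for i j
    using H(2)[of i j] d[of i] d[of j] by (simp add: diag_scale_def divide_neg_pos)
  moreover have "(\<chi> i. d i * x$i) \<noteq> 0" if "x \<noteq> 0" for x
    using d that by (auto simp: vec_eq_iff) (metis less_irrefl)
  moreover have "(\<chi> i. d i * x$i)$i = 0" if "x$i = 0" for x i using that by simp
  ultimately show ?thesis
    using G transpose_diag_scale[of G] unfolding hyperbolic_form_def form_diag_scale by blast
qed

text \<open>The kernel is spanned by a vector without zero entries, hence meets every coordinate
  hyperplane only in 0.\<close>

lemma euclidean_form_minor_pos:
  assumes G: "euclidean_form G" and x: "x$i = 0" "x \<noteq> 0"
  shows "form G x x > 0"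
proof (rule ccontr)
  assume "\<not> form G x x > 0"
  then have "form G x x = 0"
    using G by (metis euclidean_form_def less_eq_real_def)
  then obtain c z where "x = c *\<^sub>R z" "z$i > 0"
    using G by (auto simp: euclidean_form_def)
  then show False using x by auto
qed

subsection \<open>Angle Gram matrices of simplexes\<close>

lemma unit_diag_nth_self: "(\<And>i. G$i$i > 0) \<Longrightarrow> unit_diag G $ i $ i = 1"
  by (simp add: unit_diag_def less_imp_le less_imp_neq[symmetric])

lemma card_option_ge_3: "CARD('m::finite) \<ge> 2 \<Longrightarrow> CARD('m option) \<ge> 3"
  by (simp add: card_UNIV_option)

lemma angle_gram_span_eq_unit_diag:
  fixes B :: "real^'n^'n" and u w :: "'n::finite \<Rightarrow> real^'n"
  assumes card: "CARD('n) \<ge> 3" and sym: "transpose B = B" and inv: "B ** B = mat 1"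
    and dual: "\<And>i j. form B (w i) (u j) = (if i = j then 1 else 0)"
    and pos: "\<And>i x. x$i = 0 \<Longrightarrow> x \<noteq> 0 \<Longrightarrow> form (gram B w) x x > 0"
  shows "angle_gram (form B) span u = unit_diag (gram B w)"
  by (rule angle_gram_eq_unit_diag[where c = "\<lambda>_. 0"])
     (use assms involution_nondegenerate[OF inv] span_eq_dual_kernel[OF dual] in auto)

text \<open>Vertices obtained from an abstract realisation still have to be moved onto the sphere or
  hyperboloid. Their normals then take the inverse factors, to which \<open>unit_diag\<close> is
  blind.\<close>

lemma rescaled_dual:
  assumes "\<And>i j. form B (w i) (u j) = (if i = j then 1 else 0)" "\<And>i. d i > 0"
  shows "form B ((1 / d i) *\<^sub>R w i) (d j *\<^sub>R u j) = (if i = j then 1 else 0)"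
  using assms(1)[of i j] assms(2)[of i] by auto

lemma gram_rescaled: "gram B (\<lambda>i. d i *\<^sub>R w i) = diag_scale d (gram B w)"
  by (simp add: gram_def diag_scale_def vec_eq_iff mult.assoc)

section \<open>Spherical simplexes\<close>

lemma inner_eq_form: "(\<bullet>) = form (mat 1 :: real^'n^'n)"
  by (simp add: fun_eq_iff)

lemma spherical_form_gram:
  fixes u w :: "'n::finite \<Rightarrow> real^'n"
  assumes dual: "\<And>i j. form (mat 1) (w i) (u j) = (if i = j then 1 else 0)"
  shows "spherical_form (gram (mat 1) w)"
proof -
  have "(\<Sum>i\<in>UNIV. x$i *\<^sub>R w i) \<noteq> 0" if "x \<noteq> 0" for x
  proof
    assume 0: "(\<Sum>i\<in>UNIV. x$i *\<^sub>R w i) = 0"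
    have "x$j = form (mat 1) (\<Sum>i\<in>UNIV. x$i *\<^sub>R w i) (u j)" for j
      by (simp add: form_sum dual if_distrib sum.delta cong: if_cong del: form_mat_1)
    then show False using that by (simp add: 0 vec_eq_iff)
  qed
  then show ?thesis
    by (simp add: spherical_form_def form_gram transpose_gram)
qed

lemma spherical_grams_eq:
  assumes "CARD('m::finite) \<ge> 2"
  shows "(spherical_grams :: (real^('m option)^('m option)) set) =
    {A. spherical_form A \<and> (\<forall>i. A$i$i = 1)}"
proof (intro equalityI subsetI)
  fix A :: "real^('m option)^('m option)"
  assume "A \<in> spherical_grams"
  then obtain u :: "'m option \<Rightarrow> real^('m option)"
    where A: "A = angle_gram (\<bullet>) span u" and u: "spherical_simplex u"
    by (auto simp: spherical_grams_def)
  obtain w where dual: "\<And>i j. form (mat 1) (w i) (u j) = (if i = j then 1 else 0)"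
    using independent_imp_dual_exists[of u "mat 1"] u by (auto simp: spherical_simplex_def)
  have G: "spherical_form (gram (mat 1) w)" by (rule spherical_form_gram[OF dual])
  then have pos: "form (gram (mat 1) w) x x > 0" if "x \<noteq> 0" for x
    using that by (simp add: spherical_form_def)
  have eq: "A = unit_diag (gram (mat 1) w)"
    unfolding A inner_eq_form
    by (rule angle_gram_span_eq_unit_diag) (use assms dual pos in \<open>auto simp del: form_mat_1\<close>)
  have gpos: "gram (mat 1) w $ i $ i > 0" for i
    by (rule diag_pos_if_minors_pos) (use assms pos in auto)
  have "spherical_form A"
    unfolding eq unit_diag_eq_diag_scale
    by (rule spherical_form_diag_scale[OF _ G]) (use gpos in auto)
  then show "A \<in> {A. spherical_form A \<and> (\<forall>i. A$i$i = 1)}"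
    using unit_diag_nth_self[OF gpos] by (simp add: eq)
next
  fix A :: "real^('m option)^('m option)"
  assume "A \<in> {A. spherical_form A \<and> (\<forall>i. A$i$i = 1)}"
  then have G: "spherical_form A" "\<And>i. A$i$i = 1" by auto
  then have sym: "transpose A = A" and pos: "\<And>x. x \<noteq> 0 \<Longrightarrow> form A x x > 0"
    by (auto simp: spherical_form_def)
  obtain f :: "'m option \<Rightarrow> real^('m option)"
    where f: "\<And>i j. form A (f i) (f j) = (if i = j then 1 else 0)"
    using orthonormal_family_exists[OF sym subspace_UNIV pos, of "UNIV :: 'm option set"] by auto
  have "form A (f i) (f j) = mat 1$i$j" for i j by (simp add: f mat_def)
  then obtain u w :: "'m option \<Rightarrow> real^('m option)" where A: "gram (mat 1) w = A"
    and dual: "\<And>i j. form (mat 1) (w i) (u j) = (if i = j then 1 else 0)"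
    using congruent_realisation[OF sym transpose_mat matrix_mul_lid, of f] by blast
  have u0: "u i \<noteq> 0" for i using dual[of i i] by auto
  define d where "d = (\<lambda>i. 1 / norm (u i))"
  have d: "d i > 0" for i using u0 by (simp add: d_def)
  define u' where "u' = (\<lambda>i. d i *\<^sub>R u i)"
  define w' where "w' = (\<lambda>i. (1 / d i) *\<^sub>R w i)"
  have dual': "form (mat 1) (w' i) (u' j) = (if i = j then 1 else 0)" for i j
    unfolding u'_def w'_def by (rule rescaled_dual[OF dual d])
  have "spherical_simplex u'"
    unfolding spherical_simplex_def
    using dual_imp_inj[of "mat 1" w' u' "\<lambda>_. 0"] dual_imp_independent[OF dual'] dual' u0
    by (auto simp: u'_def d_def simp del: form_mat_1)
  moreover have "angle_gram (form (mat 1)) span u' = unit_diag (gram (mat 1) w')"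
    using spherical_form_gram[OF dual'] assms
    by (intro angle_gram_span_eq_unit_diag dual') (auto simp: spherical_form_def)
  moreover have "unit_diag (gram (mat 1) w') = unit_diag A"
    unfolding w'_def gram_rescaled A using d by (intro unit_diag_diag_scale) simp
  ultimately have "A = angle_gram (\<bullet>) span u'"
    using G(2) by (simp add: unit_diag_id inner_eq_form)
  then show "A \<in> spherical_grams"
    using \<open>spherical_simplex u'\<close> by (auto simp: spherical_grams_def)
qed

section \<open>Hyperbolic simplexes in the hyperboloid model\<close>

definition minkowski :: "real^('m::finite option)^('m option)" where
  "minkowski = diag (\<lambda>i. case i of None \<Rightarrow> -1 | Some _ \<Rightarrow> 1)"

lemma sum_option: "(\<Sum>i\<in>UNIV. f i) = f None + (\<Sum>k\<in>UNIV. f (Some k))"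
  for f :: "'m::finite option \<Rightarrow> 'a::comm_monoid_add"
  by (simp add: UNIV_option_conv sum.reindex)

lemma minkowski_mult_nth: "(minkowski *v y)$i = (case i of None \<Rightarrow> - y$None | Some k \<Rightarrow> y$Some k)"
  by (auto simp: minkowski_def diag_def matrix_vector_mult_def if_distrib[of "\<lambda>x. x * _"] sum.delta'
      split: option.splits cong: if_cong)

lemma transpose_minkowski: "transpose minkowski = minkowski"
  by (rule transpose_eqI) (simp add: minkowski_def diag_def)

lemma minkowski_involution: "minkowski ** minkowski = mat 1"
  by (simp add: matrix_eq vec_eq_iff minkowski_mult_nth split: option.splits
      flip: matrix_vector_mul_assoc)

lemma lorentz_eq_form: "lorentz = form minkowski"
  by (simp add: fun_eq_iff lorentz_def form_def inner_vec_def sum_option minkowski_mult_nth)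

lemma det_minkowski: "det (minkowski :: real^('m::finite option)^('m option)) = -1"
proof -
  define J where "J = (minkowski :: real^('m option)^('m option))"
  have "det J = (\<Prod>i\<in>UNIV. J$i$i)"
    unfolding J_def by (rule det_diagonal) (simp add: minkowski_def diag_def)
  also have "\<dots> = -1"
    by (simp add: UNIV_option_conv prod.reindex J_def minkowski_def diag_def)
  finally show ?thesis by (simp add: J_def)
qed

text \<open>Cauchy-Schwarz in the space-like coordinates, combined with the fact that a time-like
  vector has a space-like part shorter than its time coordinate. Hence the time coordinates alone
  decide the sign of \<open>lorentz x y\<close>.\<close>

lemma timelike_spacelike_part_less:
  assumes "lorentz x x < 0" "lorentz y y < 0"
  shows "\<bar>\<Sum>k\<in>UNIV. x$Some k * y$Some k\<bar> < \<bar>x$None * y$None\<bar>"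
proof -
  define a where "a = (\<Sum>k\<in>UNIV. x$Some k * x$Some k)"
  define b where "b = (\<Sum>k\<in>UNIV. y$Some k * y$Some k)"
  define c where "c = (\<Sum>k\<in>UNIV. x$Some k * y$Some k)"
  have x: "a < (x$None)\<^sup>2" and y: "b < (y$None)\<^sup>2"
    using assms by (auto simp: lorentz_def a_def b_def power2_eq_square)
  have "a \<ge> 0" "b \<ge> 0" by (auto simp: a_def b_def intro: sum_nonneg)
  have "c\<^sup>2 \<le> a * b"
    using Cauchy_Schwarz_ineq_sum[of "\<lambda>k. x$Some k" "\<lambda>k. y$Some k" UNIV]
    by (simp add: a_def b_def c_def power2_eq_square)
  also have "\<dots> < (x$None)\<^sup>2 * (y$None)\<^sup>2"
    using \<open>a \<ge> 0\<close> \<open>b \<ge> 0\<close> x y by (intro mult_strict_mono) auto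
  also have "\<dots> = (x$None * y$None)\<^sup>2" by (simp add: power_mult_distrib)
  finally have "\<bar>c\<bar> < \<bar>x$None * y$None\<bar>"
    by (metis abs_le_square_iff linorder_not_le)
  then show ?thesis by (simp add: c_def)
qed

lemma timelike_same_cone:
  assumes "lorentz x x < 0" "lorentz y y < 0" "lorentz x y < 0"
  shows "x$None * y$None > 0"
  using timelike_spacelike_part_less[OF assms(1,2)] assms(3) unfolding lorentz_def by linarith

lemma lorentz_neg_on_hyperboloid:
  assumes "x \<in> hyperboloid" "y \<in> hyperboloid"
  shows "lorentz x y < 0"
proof -
  have "x$None * y$None > 0" "lorentz x x < 0" "lorentz y y < 0"
    using assms by (auto simp: hyperboloid_def)
  then show ?thesis
    using timelike_spacelike_part_less[of x y] unfolding lorentz_def by linarith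
qed

text \<open>The \<open>None\<close> column \<open>h\<close> of the inverse is a negative direction
  orthogonal to the hyperplane where coordinate \<open>None\<close> vanishes, and the form is
  positive definite there. An orthonormal basis of that hyperplane together with the normalised
  \<open>h\<close> is the frame.\<close>

lemma hyperbolic_form_frame:
  fixes G :: "real^('m::finite option)^('m option)"
  assumes "hyperbolic_form G"
  shows "\<exists>f :: 'm option \<Rightarrow> real^('m option). \<forall>i j. form G (f i) (f j) = minkowski$i$j"
proof -
  obtain H where sym: "transpose G = G" and inv: "G ** H = mat 1" and neg: "\<And>i j. H$i$j < 0"
    and pos: "\<And>i x. x$i = 0 \<Longrightarrow> x \<noteq> 0 \<Longrightarrow> form G x x > 0"
    using assms by (auto simp: hyperbolic_form_def)
  define S where "S = {x::real^('m option). axis None 1 \<bullet> x = 0}"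
  have S: "x \<in> S \<longleftrightarrow> x$None = 0" for x by (simp add: S_def inner_axis')
  have "subspace S" unfolding S_def by (rule subspace_hyperplane)
  have "dim S = CARD('m)"
    using dim_hyperplane[of "axis None 1 :: real^('m option)"] by (simp add: S_def axis_eq_0_iff)
  obtain f :: "'m \<Rightarrow> real^('m option)" where f: "\<And>i. f i \<in> S"
      "\<And>i j. form G (f i) (f j) = (if i = j then 1 else 0)"
    using orthonormal_family_exists[OF sym \<open>subspace S\<close>, of "UNIV :: 'm set"] pos[of _ None] \<open>dim S = CARD('m)\<close>
    unfolding S by auto
  define h where "h = H *v axis None 1"
  have Gh: "G *v h = axis None 1" by (simp add: h_def matrix_vector_mul_assoc inv)
  then have hh: "form G h h = H$None$None"
    by (simp add: form_def inner_axis) (simp add: h_def matrix_vector_mult_basis column_def)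
  have fh: "form G (f i) h = 0" for i
    using f(1)[of i] by (simp add: form_def Gh S inner_axis)
  then have hf: "form G h (f i) = 0" for i by (simp add: form_commute[OF sym, of h])
  define c where "c = 1 / sqrt (- H$None$None)"
  have c: "c * (c * H$None$None) = -1"
    using neg[of None None] by (simp add: c_def flip: real_sqrt_mult)
  define g where "g = (\<lambda>i. case i of None \<Rightarrow> c *\<^sub>R h | Some k \<Rightarrow> f k)"
  have "form G (g i) (g j) = minkowski$i$j" for i j
    by (auto simp: g_def minkowski_def diag_def f fh hf hh c split: option.splits)
  then show ?thesis by blast
qed

text \<open>Congruence changes the determinant by the square of \<open>det F\<close>, and
  \<open>minkowski\<close> has determinant -1.\<close>

lemma hyperbolic_form_det_neg:
  fixes G :: "real^('m::finite option)^('m option)"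
  assumes "hyperbolic_form G"
  shows "det G < 0"
proof -
  obtain f :: "'m option \<Rightarrow> real^('m option)"
    where f: "\<And>i j. form G (f i) (f j) = minkowski$i$j"
    using hyperbolic_form_frame[OF assms] by blast
  define F where "F = (\<chi> i. f i)"
  have "F ** G ** transpose F = minkowski"
    by (simp add: vec_eq_iff matrix_mult_nth_eq_form f F_def)
  then have "det F * det G * det F = -1"
    using det_minkowski by (metis det_mul det_transpose)
  then have "(det F)\<^sup>2 * det G = -1" by (simp add: power2_eq_square mult.commute mult.left_commute)
  then show ?thesis
    by (metis mult_nonneg_nonneg neg_0_le_iff_le not_less not_one_le_zero zero_le_power2)
qed

lemma hyperbolic_form_gram:
  fixes u w :: "'m::finite option \<Rightarrow> real^('m option)"
  assumes dual: "\<And>i j. form minkowski (w i) (u j) = (if i = j then 1 else 0)"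
    and neg: "\<And>i j. form minkowski (u i) (u j) < 0"
  shows "hyperbolic_form (gram minkowski w)"
proof (rule hyperbolic_formI)
  show "gram minkowski w ** gram minkowski u = mat 1"
    by (rule gram_dual_inverse[OF dual transpose_minkowski])
  show "gram minkowski u $ i $ j < 0" for i j using neg by (simp add: gram_def)
  show "transpose (gram minkowski w) = gram minkowski w"
    by (rule transpose_gram[OF transpose_minkowski])
  \<comment> \<open>The hyperplane consists of the coefficient vectors whose combination of normals
    has zero time coordinate; there the Lorentz form is a sum of squares.\<close>
  fix y assume y: "(\<chi> i. w i $ None) \<bullet> y = 0"
  have "(\<Sum>i\<in>UNIV. y$i *\<^sub>R w i) $ None = 0"
    using y by (simp add: inner_vec_def mult.commute)
  then show "form (gram minkowski w) y y \<ge> 0"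
    unfolding form_gram
    by (simp add: sum_nonneg lorentz_def flip: lorentz_eq_form)
qed

lemma hyperbolic_grams_eq:
  assumes card: "CARD('m::finite) \<ge> 2"
  shows "(hyperbolic_grams :: (real^('m option)^('m option)) set) =
    {A. hyperbolic_form A \<and> (\<forall>i. A$i$i = 1)}"
proof (intro equalityI subsetI)
  fix A :: "real^('m option)^('m option)"
  assume "A \<in> hyperbolic_grams"
  then obtain u :: "'m option \<Rightarrow> real^('m option)"
    where A: "A = angle_gram lorentz span u" and u: "hyperbolic_simplex u"
    by (auto simp: hyperbolic_grams_def)
  obtain w where dual: "\<And>i j. form minkowski (w i) (u j) = (if i = j then 1 else 0)"
    using independent_imp_dual_exists[OF _ _ transpose_minkowski minkowski_involution, of u] u
    by (auto simp: hyperbolic_simplex_def)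
  have G: "hyperbolic_form (gram minkowski w)"
    by (rule hyperbolic_form_gram[OF dual])
       (use u lorentz_neg_on_hyperboloid in \<open>auto simp: hyperbolic_simplex_def lorentz_eq_form\<close>)
  then have pos: "form (gram minkowski w) x x > 0" if "x$i = 0" "x \<noteq> 0" for x i
    using that by (auto simp: hyperbolic_form_def)
  have eq: "A = unit_diag (gram minkowski w)"
    unfolding A lorentz_eq_form
    by (rule angle_gram_span_eq_unit_diag[OF _ transpose_minkowski minkowski_involution])
       (use card dual pos in auto)
  have gpos: "gram minkowski w $ i $ i > 0" for i
    by (rule diag_pos_if_minors_pos) (use card pos in auto)
  have "hyperbolic_form A"
    unfolding eq unit_diag_eq_diag_scale
    by (rule hyperbolic_form_diag_scale[OF _ G]) (use gpos in auto)
  then show "A \<in> {A. hyperbolic_form A \<and> (\<forall>i. A$i$i = 1)}"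
    using unit_diag_nth_self[OF gpos] by (simp add: eq)
next
  fix A :: "real^('m option)^('m option)"
  assume "A \<in> {A. hyperbolic_form A \<and> (\<forall>i. A$i$i = 1)}"
  then have G: "hyperbolic_form A" "\<And>i. A$i$i = 1" by auto
  then obtain H where sym: "transpose A = A" and H: "A ** H = mat 1" "\<And>i j. H$i$j < 0"
    by (auto simp: hyperbolic_form_def)
  obtain f :: "'m option \<Rightarrow> real^('m option)"
    where f: "\<And>i j. form A (f i) (f j) = minkowski$i$j"
    using hyperbolic_form_frame[OF G(1)] by blast
  obtain u w :: "'m option \<Rightarrow> real^('m option)" where gw: "gram minkowski w = A"
    and dual: "\<And>i j. form minkowski (w i) (u j) = (if i = j then 1 else 0)"
    using congruent_realisation[OF sym transpose_minkowski minkowski_involution f] by blast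
  have "A ** gram minkowski u = mat 1"
    using gram_dual_inverse[OF dual transpose_minkowski] gw by simp
  \<comment> \<open>By uniqueness of the inverse, the negative entries of \<open>H\<close> are the
    Lorentz products of the vertices found.\<close>
  then have "gram minkowski u = H"
    by (metis H(1) matrix_left_right_inverse matrix_mul_assoc matrix_mul_lid matrix_mul_rid)
  then have neg: "form minkowski (u i) (u j) < 0" for i j
    using H(2)[of i j] by (auto simp: gram_def)
  have same: "u i $ None * u j $ None > 0" for i j
    by (rule timelike_same_cone) (use neg in \<open>auto simp: lorentz_eq_form\<close>)
  \<comment> \<open>The vertices share one cone, possibly the lower one. A common sign moves them to
    the upper sheet; the normals change sign too, which affects neither duality nor Gram
    matrices.\<close>
  define s where "s = sgn (u None $ None)"
  have s: "s * s = 1" and su: "s * u i $ None > 0" for i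
    using same[of None None] same[of i None]
    by (auto simp: s_def sgn_if zero_less_mult_iff split: if_splits)
  define d where "d = (\<lambda>i. 1 / sqrt (- form minkowski (u i) (u i)))"
  have d: "d i > 0" for i using neg[of i i] by (simp add: d_def)
  define u' where "u' = (\<lambda>i. d i *\<^sub>R (s *\<^sub>R u i))"
  define w' where "w' = (\<lambda>i. (1 / d i) *\<^sub>R (s *\<^sub>R w i))"
  have dual0: "form minkowski (s *\<^sub>R w i) (s *\<^sub>R u j) = (if i = j then 1 else 0)" for i j
    using dual[of i j] s by (simp flip: mult.assoc)
  have dual': "form minkowski (w' i) (u' j) = (if i = j then 1 else 0)" for i j
    unfolding u'_def w'_def by (rule rescaled_dual[OF dual0 d])
  have neg': "form minkowski (u' i) (u' j) < 0" for i j
  proof -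
    have "form minkowski (u' i) (u' j) = (s * s) * (d i * d j) * form minkowski (u i) (u j)"
      by (simp add: u'_def)
    then show ?thesis using neg d s by (simp add: mult_pos_neg)
  qed
  have hyp: "u' i \<in> hyperboloid" for i
  proof -
    have "form minkowski (u' i) (u' i) = (s * s) * (d i * d i) * form minkowski (u i) (u i)"
      by (simp add: u'_def)
    also have "\<dots> = -1"
      using neg[of i i] s by (simp add: d_def flip: real_sqrt_mult)
    finally show ?thesis
      using mult_pos_pos[OF d[of i] su[of i]] by (simp add: hyperboloid_def lorentz_eq_form u'_def mult.assoc)
  qed
  have "hyperbolic_simplex u'"
    using dual_imp_inj[of minkowski w' u' "\<lambda>_. 0"] dual_imp_independent[OF dual'] dual' hyp
    by (auto simp: hyperbolic_simplex_def)
  moreover have "angle_gram (form minkowski) span u' = unit_diag (gram minkowski w')"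
    using hyperbolic_form_gram[OF dual' neg'] card
    by (intro angle_gram_span_eq_unit_diag[OF _ transpose_minkowski minkowski_involution dual'])
       (auto simp: hyperbolic_form_def)
  moreover have "gram minkowski (\<lambda>i. s *\<^sub>R w i) = A"
    using s by (simp add: gram_rescaled gw diag_scale_def vec_eq_iff)
  then have "unit_diag (gram minkowski w') = unit_diag A"
    unfolding w'_def gram_rescaled[of _ _ "\<lambda>i. s *\<^sub>R w i"] using d by (simp add: unit_diag_diag_scale)
  ultimately have "A = angle_gram lorentz span u'"
    using G(2) by (simp add: unit_diag_id lorentz_eq_form)
  then show "A \<in> hyperbolic_grams"
    using \<open>hyperbolic_simplex u'\<close> by (auto simp: hyperbolic_grams_def)
qed

section \<open>Euclidean simplexes and barycentric coordinates\<close>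

lemma affine_combination_in_hull:
  fixes u :: "'i \<Rightarrow> 'v::real_vector"
  assumes "finite I" "inj_on u I" "I \<noteq> {}" "sum c I = 1"
  shows "(\<Sum>i\<in>I. c i *\<^sub>R u i) \<in> affine hull (u ` I)"
proof -
  define c' where "c' = (\<lambda>v. c (inv_into I u v))"
  have eq: "(\<Sum>v\<in>u ` I. c' v *\<^sub>R v) = (\<Sum>i\<in>I. c i *\<^sub>R u i)"
    using assms(2) by (simp add: sum.reindex c'_def)
  have "sum c' (u ` I) = 1"
    using assms(2,4) by (simp add: sum.reindex c'_def)
  then have "(\<Sum>v\<in>u ` I. c' v *\<^sub>R v) \<in> affine hull (u ` I)"
    by (intro iffD1[OF affine affine_affine_hull, rule_format] conjI)
       (use assms in \<open>simp_all add: hull_subset\<close>)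
  then show ?thesis by (simp add: eq)
qed

lemma sum_neutral_complement:
  "(\<And>i. i \<notin> S \<Longrightarrow> f i = 0) \<Longrightarrow> sum f (UNIV :: 'i::finite set) = sum f S"
  by (rule sum.mono_neutral_right) auto

text \<open>
  The barycentric coordinates of \<open>y\<close> are \<open>w i \<bullet> y - c i\<close>; the \<open>w i\<close> are their gradients, so they sum to \<open>0\<close>.
\<close>

lemma euclidean_simplex_barycentric:
  fixes u :: "'m::finite option \<Rightarrow> real^'m" and v :: "'m \<Rightarrow> real^'m"
  assumes card: "CARD('m) \<ge> 2"
    and dual: "\<And>k l. v k \<bullet> (u (Some l) - u None) = (if k = l then 1 else 0)"
    and w: "w = (\<lambda>i. case i of None \<Rightarrow> - sum v UNIV | Some k \<Rightarrow> v k)"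
  shows "euclidean_simplex u" "euclidean_form (gram (mat 1) w)"
    "angle_gram (\<bullet>) (\<lambda>S. affine hull S) u = unit_diag (gram (mat 1) w)"
proof -
  \<comment> \<open>The constants make each coordinate 0 at the other vertices and 1 at its own; for
    \<open>None\<close> all its values at other vertices are lower by 1 than at
    \<open>u None\<close>, hence the \<open>- 1\<close>.\<close>
  define c where "c = (\<lambda>i. case i of None \<Rightarrow> w None \<bullet> u None - 1 | Some k \<Rightarrow> w (Some k) \<bullet> u None)"
  have sum_v: "sum v UNIV \<bullet> (u (Some l) - u None) = 1" for l
    unfolding inner_sum_left by (simp add: dual)
  have wu: "w i \<bullet> u j = c i + (if i = j then 1 else 0)" for i j
    using dual[unfolded inner_diff_right] sum_v[unfolded inner_diff_right]
    by (cases i; cases j) (auto simp: c_def w algebra_simps)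
  have inj: "inj u" by (rule dual_imp_inj[of "mat 1" w u c]) (simp add: wu)
  have "u i \<notin> affine hull (range u - {u i})" for i
  proof
    assume "u i \<in> affine hull (range u - {u i})"
    moreover have "affine hull (range u - {u i}) \<subseteq> {y. w i \<bullet> y = c i}"
      by (rule hull_minimal) (auto simp: wu affine_hyperplane)
    ultimately show False using wu[of i i] by auto
  qed
  then show "euclidean_simplex u"
    using inj by (auto simp: euclidean_simplex_def affine_dependent_def)
  have sum_coord: "(\<Sum>i\<in>UNIV. w i \<bullet> y - c i) = 1" for y
    by (simp add: sum_option c_def w sum_subtractf inner_sum_left)
  have weighted: "(\<Sum>i\<in>UNIV. a i *\<^sub>R (u i - p)) = (\<Sum>i\<in>UNIV. a i *\<^sub>R u i) - (\<Sum>i\<in>UNIV. a i) *\<^sub>R p" for a p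
    by (simp add: scaleR_diff_right sum_subtractf scaleR_sum_left)
  have expand: "(\<Sum>i\<in>UNIV. (w i \<bullet> y - c i) *\<^sub>R u i) = y" for y
  proof -
    have "(\<Sum>k\<in>UNIV. (v k \<bullet> (y - u None)) *\<^sub>R (u (Some k) - u None)) = y - u None"
      using dual_expand[of "mat 1" v "\<lambda>k. u (Some k) - u None" "y - u None"] dual
      by (simp add: inner_diff_right)
    moreover have "(\<Sum>i\<in>UNIV. (w i \<bullet> y - c i) *\<^sub>R (u i - u None)) =
        (\<Sum>k\<in>UNIV. (v k \<bullet> (y - u None)) *\<^sub>R (u (Some k) - u None))"
      by (simp add: sum_option c_def w inner_diff_right)
    moreover have "(\<Sum>i\<in>UNIV. (w i \<bullet> y - c i) *\<^sub>R (u i - u None)) =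
        (\<Sum>i\<in>UNIV. (w i \<bullet> y - c i) *\<^sub>R u i) - u None"
      using weighted[of "\<lambda>i. w i \<bullet> y - c i" "u None"] unfolding sum_coord by simp
    ultimately show ?thesis by simp
  qed
  have hull: "affine hull (u ` (- {i, j})) = {y. w i \<bullet> y = c i \<and> w j \<bullet> y = c j}" (is "?L = ?R")
    if "i \<noteq> j" for i j
  proof
    have "?R = {y. w i \<bullet> y = c i} \<inter> {y. w j \<bullet> y = c j}" by auto
    then have "affine ?R" by (simp add: affine_Int affine_hyperplane)
    then show "?L \<subseteq> ?R"
      by (intro hull_minimal) (auto simp: wu)
    show "?R \<subseteq> ?L"
    proof
      fix y assume y: "y \<in> ?R"
      let ?I = "- {i, j}"
      have 1: "(\<Sum>k\<in>?I. w k \<bullet> y - c k) = 1"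
        using sum_coord[of y] y by (subst sum_neutral_complement[symmetric]) auto
      have "y = (\<Sum>k\<in>?I. (w k \<bullet> y - c k) *\<^sub>R u k)"
        using expand[of y] y by (subst sum_neutral_complement[symmetric]) auto
      also have "\<dots> \<in> ?L"
        using 1 inj by (intro affine_combination_in_hull) (auto simp: inj_on_def)
      finally show "y \<in> ?L" .
    qed
  qed
  \<comment> \<open>As the normals sum to 0, only the differences to the entry at
    \<open>None\<close> matter; so the constant vectors span the kernel.\<close>
  have form_eq: "form (gram (mat 1) w) x x = (norm (\<Sum>k\<in>UNIV. (x$Some k - x$None) *\<^sub>R v k))\<^sup>2" for x
  proof -
    have "(\<Sum>i\<in>UNIV. x$i *\<^sub>R w i) = (\<Sum>k\<in>UNIV. (x$Some k - x$None) *\<^sub>R v k)"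
      by (simp add: sum_option w scaleR_diff_left sum_subtractf scaleR_sum_right)
    then show ?thesis by (simp only: form_gram form_mat_1 power2_norm_eq_inner)
  qed
  have sym: "transpose (gram (mat 1) w) = gram (mat 1) w"
    by (rule transpose_gram) simp
  show G: "euclidean_form (gram (mat 1) w)"
    unfolding euclidean_form_def
  proof (intro conjI exI allI impI sym)
    let ?x = "(\<chi> i. 1) :: real^('m option)"
    show "form (gram (mat 1) w) y y \<ge> 0" for y by (simp add: form_eq)
    then show "gram (mat 1) w *v ?x = 0"
      by (intro psd_form_zero sym) (simp_all add: form_eq)
    show "?x $ i > 0" for i by simp
    fix y assume "form (gram (mat 1) w) y y = 0"
    then have 0: "(\<Sum>k\<in>UNIV. (y$Some k - y$None) *\<^sub>R v k) = 0" by (simp add: form_eq)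
    have "y$Some l - y$None = (\<Sum>k\<in>UNIV. (y$Some k - y$None) *\<^sub>R v k) \<bullet> (u (Some l) - u None)" for l
      by (simp only: inner_sum_left inner_scaleR_left dual) (simp add: if_distrib sum.delta cong: if_cong)
    then have "y$Some l = y$None" for l by (simp add: 0)
    then have "y$i = y$None" for i by (cases i) auto
    then show "y = (y$None) *\<^sub>R ?x" by (simp add: vec_eq_iff)
  qed
  show "angle_gram (\<bullet>) (\<lambda>S. affine hull S) u = unit_diag (gram (mat 1) w)"
    unfolding inner_eq_form
    by (rule angle_gram_eq_unit_diag[where c = c])
       (use card hull wu euclidean_form_minor_pos[OF G] in auto)
qed

lemma euclidean_grams_eq:
  assumes card: "CARD('m::finite) \<ge> 2"
  shows "(euclidean_grams :: (real^('m option)^('m option)) set) =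
    {A. euclidean_form A \<and> (\<forall>i. A$i$i = 1)}"
proof (intro equalityI subsetI)
  fix A :: "real^('m option)^('m option)"
  assume "A \<in> euclidean_grams"
  then obtain u :: "'m option \<Rightarrow> real^'m"
    where A: "A = angle_gram (\<bullet>) (\<lambda>S. affine hull S) u" and u: "euclidean_simplex u"
    by (auto simp: euclidean_grams_def)
  define e where "e = (\<lambda>k. u (Some k) - u None)"
  have inj: "inj u" and aff: "\<not> affine_dependent (range u)"
    using u by (auto simp: euclidean_simplex_def)
  have "inj e" using inj by (auto simp: inj_def e_def)
  have "range u = insert (u None) (range (\<lambda>k. u (Some k)))"
    by (auto simp: UNIV_option_conv)
  moreover have "u None \<notin> range (\<lambda>k. u (Some k))"
    using inj by (auto simp: inj_def)
  ultimately have "independent ((\<lambda>x. - u None + x) ` range (\<lambda>k. u (Some k)))"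
    using aff affine_dependent_iff_dependent by metis
  moreover have "(\<lambda>x. - u None + x) ` range (\<lambda>k. u (Some k)) = range e"
    by (auto simp: e_def image_image)
  ultimately have "independent (range e)" by simp
  then obtain v where v: "\<And>k l. form (mat 1) (v k) (e l) = (if k = l then 1 else 0)"
    using independent_imp_dual_exists[of e "mat 1"] \<open>inj e\<close> by auto
  define w where "w = (\<lambda>i. case i of None \<Rightarrow> - sum v UNIV | Some k \<Rightarrow> v k)"
  have dual: "v k \<bullet> (u (Some l) - u None) = (if k = l then 1 else 0)" for k l
    using v[of k l] by (simp add: e_def inner_diff_right)
  note bary = euclidean_simplex_barycentric[OF card dual w_def]
  have gpos: "gram (mat 1) w $ i $ i > 0" for i
    by (rule diag_pos_if_minors_pos) (use card euclidean_form_minor_pos[OF bary(2)] in auto)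
  have "euclidean_form A"
    unfolding A bary(3) unit_diag_eq_diag_scale
    by (rule euclidean_form_diag_scale[OF _ bary(2)]) (use gpos in auto)
  then show "A \<in> {A. euclidean_form A \<and> (\<forall>i. A$i$i = 1)}"
    using unit_diag_nth_self[OF gpos] by (simp add: A bary(3))
next
  fix A :: "real^('m option)^('m option)"
  assume "A \<in> {A. euclidean_form A \<and> (\<forall>i. A$i$i = 1)}"
  then have G: "euclidean_form A" "\<And>i. A$i$i = 1" by auto
  then obtain x where x: "\<And>i. x$i > 0" "A *v x = 0" and sym: "transpose A = A"
    by (auto simp: euclidean_form_def)
  \<comment> \<open>Scaling by the kernel vector moves the kernel to the constant vectors. The rows
    then sum to 0, as they must for the Gram matrix of gradients of barycentric coordinates.\<close>
  define S where "S = diag_scale (\<lambda>i. x$i) A"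
  have symS: "transpose S = S" using sym by (simp add: S_def transpose_diag_scale)
  have rowS: "(\<Sum>j\<in>UNIV. S$i$j) = 0" for i
  proof -
    have "(\<Sum>j\<in>UNIV. S$i$j) = x$i * (A *v x)$i"
      by (simp add: S_def diag_scale_def matrix_vector_mult_def sum_distrib_left ac_simps)
    then show ?thesis using x by simp
  qed
  \<comment> \<open>Dropping \<open>None\<close> leaves a positive definite matrix, realised below
    as the Gram matrix of \<open>v\<close>; the vanishing row sums show that
    \<open>- sum v UNIV\<close> is the right remaining normal.\<close>
  define P :: "real^'m^'m" where "P = (\<chi> k l. S$Some k$Some l)"
  have symP: "transpose P = P"
    by (rule transpose_eqI) (simp add: P_def transpose_nth_eq[OF symS])
  have posP: "form P y y > 0" if "y \<noteq> 0" for y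
  proof -
    define z :: "real^('m option)" where "z = (\<chi> i. case i of None \<Rightarrow> 0 | Some k \<Rightarrow> y$k)"
    have "form P y y = form S z z"
      by (simp add: form_expand sum_option z_def P_def)
    moreover have "z \<noteq> 0" "z$None = 0" using that by (auto simp: z_def vec_eq_iff split: option.splits)
    ultimately show ?thesis
      using euclidean_form_minor_pos[OF euclidean_form_diag_scale[OF x(1) G(1)], of z None]
      by (simp add: S_def)
  qed
  obtain f :: "'m \<Rightarrow> real^'m" where f: "\<And>i j. form P (f i) (f j) = (if i = j then 1 else 0)"
    using orthonormal_family_exists[OF symP subspace_UNIV posP, of "UNIV :: 'm set"] by auto
  have "form P (f i) (f j) = mat 1$i$j" for i j by (simp add: f mat_def)
  then obtain e v :: "'m \<Rightarrow> real^'m" where gv: "gram (mat 1) v = P"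
    and ev: "\<And>i j. form (mat 1) (v i) (e j) = (if i = j then 1 else 0)"
    using congruent_realisation[OF symP transpose_mat matrix_mul_lid, of f] by blast
  have vv: "v k \<bullet> v l = S$Some k$Some l" for k l
    using gv by (simp add: gram_def P_def vec_eq_iff)
  define u where "u = (\<lambda>i. case i of None \<Rightarrow> 0 | Some k \<Rightarrow> e k)"
  define w where "w = (\<lambda>i. case i of None \<Rightarrow> - sum v UNIV | Some k \<Rightarrow> v k)"
  have dual: "v k \<bullet> (u (Some l) - u None) = (if k = l then 1 else 0)" for k l
    using ev[of k l] by (simp add: u_def)
  note bary = euclidean_simplex_barycentric[OF card dual w_def]
  have col: "(\<Sum>k\<in>UNIV. S$Some k$i) = - S$None$i" for i
    using rowS[of i] transpose_nth_eq[OF symS, of i] by (simp add: sum_option)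
  have row: "(\<Sum>k\<in>UNIV. S$i$Some k) = - S$i$None" for i
    using rowS[of i] by (simp add: sum_option)
  have "w i \<bullet> w j = S$i$j" for i j
    by (cases i; cases j)
       (simp_all add: w_def inner_sum_left inner_sum_right vv row col sum_negf)
  then have "gram (mat 1) w = S"
    by (simp add: gram_def vec_eq_iff)
  then have "angle_gram (\<bullet>) (\<lambda>S. affine hull S) u = unit_diag A"
    using bary(3) x(1) by (simp add: S_def unit_diag_diag_scale)
  then have "A = angle_gram (\<bullet>) (\<lambda>S. affine hull S) u"
    using G(2) by (simp add: unit_diag_id)
  then show "A \<in> euclidean_grams"
    using bary(1) by (auto simp: euclidean_grams_def)
qed

subsection \<open>Approximation\<close>

lemma tendsto_matrixI:
  fixes f :: "'a \<Rightarrow> real^'n^'m"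
  shows "(\<And>i j. ((\<lambda>t. f t$i$j) \<longlongrightarrow> A$i$j) F) \<Longrightarrow> (f \<longlongrightarrow> A) F"
  by (intro vec_tendstoI)

lemma tendsto_form:
  assumes "(A \<longlongrightarrow> a) F" "(x \<longlongrightarrow> p) F" "(y \<longlongrightarrow> q) F"
  shows "((\<lambda>t. form (A t) (x t) (y t)) \<longlongrightarrow> form a p q) F"
  unfolding form_expand by (intro tendsto_intros assms)

lemma tendsto_matrix_mult:
  fixes A :: "'a \<Rightarrow> real^'n^'m" and B :: "'a \<Rightarrow> real^'p^'n"
  assumes "(A \<longlongrightarrow> a) F" "(B \<longlongrightarrow> b) F"
  shows "((\<lambda>t. A t ** B t) \<longlongrightarrow> a ** b) F"
  by (rule tendsto_matrixI, unfold matrix_matrix_mult_def, simp, intro tendsto_intros assms)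

lemma tendsto_det:
  fixes A :: "'a \<Rightarrow> real^'n^'n"
  assumes "(A \<longlongrightarrow> a) F"
  shows "((\<lambda>t. det (A t)) \<longlongrightarrow> det a) F"
  unfolding det_def by (intro tendsto_intros assms)

lemma tendsto_adj_on_UNIV:
  fixes A :: "'a \<Rightarrow> real^'n^'n"
  assumes "(A \<longlongrightarrow> a) F"
  shows "((\<lambda>t. adj_on UNIV (A t) i j) \<longlongrightarrow> adj_on UNIV a i j) F"
  unfolding adj_on_def det_on_UNIV
  by (intro tendsto_det tendsto_matrixI) (auto intro!: tendsto_intros assms)

lemma tendsto_unit_diag:
  assumes "(f \<longlongrightarrow> A) F" "\<And>i. A$i$i = 1"
  shows "((\<lambda>t. unit_diag (f t)) \<longlongrightarrow> A) F"
proof (rule tendsto_matrixI)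
  fix i j
  have "((\<lambda>t. f t$i$j / (sqrt (f t$i$i) * sqrt (f t$j$j))) \<longlongrightarrow>
      A$i$j / (sqrt (A$i$i) * sqrt (A$j$j))) F"
    by (intro tendsto_intros assms(1)) (simp add: assms(2))
  then show "((\<lambda>t. unit_diag (f t)$i$j) \<longlongrightarrow> A$i$j) F"
    by (simp add: unit_diag_def assms(2))
qed

lemma unit_diag_forms:
  fixes G :: "real^'n^'n"
  assumes card: "CARD('n) \<ge> 3"
  shows "spherical_form G \<Longrightarrow> spherical_form (unit_diag G) \<and> (\<forall>i. unit_diag G$i$i = 1)"
    and "euclidean_form G \<Longrightarrow> euclidean_form (unit_diag G) \<and> (\<forall>i. unit_diag G$i$i = 1)"
    and "hyperbolic_form G \<Longrightarrow> hyperbolic_form (unit_diag G) \<and> (\<forall>i. unit_diag G$i$i = 1)"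
proof -
  have pos: "G$i$i > 0" if "\<And>i x. x$i = 0 \<Longrightarrow> x \<noteq> 0 \<Longrightarrow> form G x x > 0" for i
    by (rule diag_pos_if_minors_pos[OF card that])
  show "spherical_form (unit_diag G) \<and> (\<forall>i. unit_diag G$i$i = 1)" if G: "spherical_form G"
  proof -
    have "G$i$i > 0" for i using G by (intro pos) (auto simp: spherical_form_def)
    then show ?thesis
      using unit_diag_nth_self[of G] spherical_form_diag_scale[OF _ G]
      by (simp add: unit_diag_eq_diag_scale)
  qed
  show "euclidean_form (unit_diag G) \<and> (\<forall>i. unit_diag G$i$i = 1)" if G: "euclidean_form G"
  proof -
    have "G$i$i > 0" for i using euclidean_form_minor_pos[OF G] by (rule pos)
    then show ?thesis
      using unit_diag_nth_self[of G] euclidean_form_diag_scale[OF _ G]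
      by (simp add: unit_diag_eq_diag_scale)
  qed
  show "hyperbolic_form (unit_diag G) \<and> (\<forall>i. unit_diag G$i$i = 1)" if G: "hyperbolic_form G"
  proof -
    have "G$i$i > 0" for i using G by (intro pos) (auto simp: hyperbolic_form_def)
    then show ?thesis
      using unit_diag_nth_self[of G] hyperbolic_form_diag_scale[OF _ G]
      by (simp add: unit_diag_eq_diag_scale)
  qed
qed

lemma closure_if_unit_diag_tendsto:
  assumes "(f \<longlongrightarrow> A) (at_right (0::real))" "\<And>i. A$i$i = 1"
    and "\<forall>\<^sub>F t in at_right 0. unit_diag (f t) \<in> S"
  shows "A \<in> closure S"
proof (rule Lim_in_closed_set[OF closed_closure])
  show "((\<lambda>t. unit_diag (f t)) \<longlongrightarrow> A) (at_right 0)"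
    by (rule tendsto_unit_diag[OF assms(1,2)])
  show "\<forall>\<^sub>F t in at_right 0. unit_diag (f t) \<in> closure S"
    using assms(3) by eventually_elim (use closure_subset in blast)
qed simp

section \<open>Rank-one perturbations\<close>

definition outer :: "real^'n \<Rightarrow> real^'n \<Rightarrow> real^'n^'n" where
  "outer x y = (\<chi> i j. x$i * y$j)"

lemma outer_mult [simp]: "outer x y *v z = (y \<bullet> z) *\<^sub>R x"
  by (simp add: vec_eq_iff outer_def matrix_vector_mult_def inner_vec_def sum_distrib_left sum_distrib_right ac_simps)

lemma form_outer: "form (outer x x) y z = (x \<bullet> y) * (x \<bullet> z)"
  by (simp add: form_def inner_commute mult.commute)

lemma transpose_outer: "transpose (outer x x) = outer x x"
  by (rule transpose_eqI) (simp add: outer_def mult.commute)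

lemma transpose_add_scaled:
  fixes A B :: "real^'n^'n"
  assumes "transpose A = A" "transpose B = B"
  shows "transpose (A + c *\<^sub>R B) = A + c *\<^sub>R B" "transpose (A - c *\<^sub>R B) = A - c *\<^sub>R B"
  using assms by (simp_all add: vec_eq_iff transpose_def)

lemma matrix_scaled_mult:
  "(A + c *\<^sub>R B) *v y = A *v y + c *\<^sub>R (B *v y)"
  "(A - c *\<^sub>R B) *v y = A *v y - c *\<^sub>R (B *v y)"
  for A B :: "real^'n^'m"
  by (simp_all add: matrix_vector_mult_add_rdistrib matrix_vector_mult_diff_rdistrib
      scaleR_matrix_vector_assoc)

definition nonneg_kernel :: "real^'n^'n \<Rightarrow> bool" where
  "nonneg_kernel A \<longleftrightarrow> (\<exists>x. (\<forall>i. x$i \<ge> 0) \<and> x \<noteq> 0 \<and> A *v x = 0)"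

text \<open>
  Compress \<open>A + t\<close> to the hyperplane orthogonal to \<open>x + t (1, \<dots>, 1)\<close>: this vector is positive
  and spans the kernel of the result.
\<close>

lemma euclidean_form_approximation:
  fixes A :: "real^'n^'n"
  assumes sym: "transpose A = A" and psd: "\<And>y. form A y y \<ge> 0" and "nonneg_kernel A"
  shows "\<exists>f. (f \<longlongrightarrow> A) (at_right (0::real)) \<and> (\<forall>t>0. euclidean_form (f t))"
proof -
  obtain x where x: "\<And>i. x$i \<ge> 0" "x \<noteq> 0" "A *v x = 0"
    using assms(3) by (auto simp: nonneg_kernel_def)
  define z where "z = (\<lambda>t::real. x + t *\<^sub>R (\<chi> i. 1))"
  \<comment> \<open>Orthogonal projection along \<open>z t\<close>. Thanks to the summand
    \<open>t\<close> in the compressed matrix, the form vanishes only where \<open>Q t\<close> does,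
    that is on multiples of \<open>z t\<close>.\<close>
  define Q where "Q = (\<lambda>t. mat 1 - (1 / (z t \<bullet> z t)) *\<^sub>R outer (z t) (z t))"
  define f where "f = (\<lambda>t. transpose (Q t) ** (A + t *\<^sub>R mat 1) ** Q t)"
  have symQ: "transpose (Q t) = Q t" for t
    unfolding Q_def by (intro transpose_add_scaled transpose_outer) simp
  have Qy: "Q t *v y = y - ((z t \<bullet> y) / (z t \<bullet> z t)) *\<^sub>R z t" for t y
    by (simp add: Q_def matrix_scaled_mult)
  have form_f: "form (f t) y w = form A (Q t *v y) (Q t *v w) + t * ((Q t *v y) \<bullet> (Q t *v w))" for t y w
    unfolding f_def form_matrix_mult by (simp add: form_linear_matrix)
  have "euclidean_form (f t)" if "t > 0" for t
    unfolding euclidean_form_def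
  proof (intro conjI allI exI impI)
    show symf: "transpose (f t) = f t"
      by (rule transpose_eqI)
         (use form_commute[OF sym] in \<open>simp add: form_f inner_commute flip: form_axis\<close>)
    show nonneg: "form (f t) y y \<ge> 0" for y
      using psd that by (simp add: form_f)
    show zpos: "z t $ i > 0" for i using x(1)[of i] that by (simp add: z_def)
    then have "z t \<noteq> 0" by (metis less_irrefl zero_index)
    then have "Q t *v z t = 0" by (simp add: Qy)
    then show "f t *v z t = 0"
      by (intro psd_form_zero symf nonneg) (simp add: form_f)
    fix y assume "form (f t) y y = 0"
    then have "t * ((Q t *v y) \<bullet> (Q t *v y)) \<le> 0" using psd[of "Q t *v y"] by (simp add: form_f)
    then have "Q t *v y = 0" using that by (simp add: mult_le_0_iff flip: power2_norm_eq_inner)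
    then show "y = ((z t \<bullet> y) / (z t \<bullet> z t)) *\<^sub>R z t" by (simp add: Qy)
  qed
  moreover have "(f \<longlongrightarrow> A) (at_right 0)"
  proof -
    have t0: "((\<lambda>t::real. t) \<longlongrightarrow> 0) (at_right 0)" by (rule tendsto_ident_at)
    have z: "(z \<longlongrightarrow> x) (at_right 0)"
      unfolding z_def using t0 by (auto intro!: tendsto_eq_intros)
    define P where "P = mat 1 - (1 / (x \<bullet> x)) *\<^sub>R outer x x"
    have Q: "(Q \<longlongrightarrow> P) (at_right 0)"
    proof (rule tendsto_matrixI)
      fix i j
      have "((\<lambda>t. mat 1$i$j - (1 / (z t \<bullet> z t)) * (z t$i * z t$j)) \<longlongrightarrow>
          mat 1$i$j - (1 / (x \<bullet> x)) * (x$i * x$j)) (at_right 0)"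
        by (intro tendsto_intros z) (simp add: x)
      then show "((\<lambda>t. Q t$i$j) \<longlongrightarrow> P$i$j) (at_right 0)"
        by (simp add: Q_def P_def outer_def)
    qed
    have B: "((\<lambda>t. A + t *\<^sub>R mat 1) \<longlongrightarrow> A) (at_right 0)"
      using t0 by (auto intro!: tendsto_eq_intros)
    have "(f \<longlongrightarrow> P ** A ** P) (at_right 0)"
      unfolding f_def symQ by (intro tendsto_matrix_mult Q B)
    \<comment> \<open>In the kernel of the symmetric matrix \<open>A\<close>, \<open>x\<close> is
      orthogonal to the range of \<open>A\<close>; projecting along \<open>x\<close> on either side
      changes nothing.\<close>
    moreover have "P ** A ** P = A"
    proof -
      have Py: "P *v y = y - ((x \<bullet> y) / (x \<bullet> x)) *\<^sub>R x" for y
        by (simp add: P_def matrix_scaled_mult)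
      have "x \<bullet> (A *v y) = 0" for y
        using form_commute[OF sym, of x y] x(3) by (simp add: form_def)
      then have "P *v (A *v (P *v y)) = A *v y" for y
        using x(3) by (simp add: Py matrix_vector_mult_diff_distrib matrix_vector_mult_scaleR)
      then show ?thesis by (simp add: matrix_eq flip: matrix_vector_mul_assoc)
    qed
    ultimately show ?thesis by simp
  qed
  ultimately show ?thesis by blast
qed

text \<open>Adding x x^T to \<open>G\<close> makes it invertible with inverse \<open>P\<close>, and
  subtracting t x x^T from \<open>G\<close> is a rank-one update of that matrix. Its inverse
  acquires a term of order 1/t along x x^T with negative sign, and this term dominates every entry
  because \<open>x\<close> is positive.\<close>

lemma hyperbolic_form_approximation_euclidean:
  fixes G :: "real^'n^'n"
  assumes "euclidean_form G"
  shows "\<exists>f. (f \<longlongrightarrow> G) (at_right (0::real)) \<and> (\<forall>\<^sub>F t in at_right 0. hyperbolic_form (f t))"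
proof -
  obtain x where sym: "transpose G = G" and psd: "\<And>y. form G y y \<ge> 0"
    and x: "\<And>i. x$i > 0" "G *v x = 0" "\<And>y. form G y y = 0 \<Longrightarrow> \<exists>c. y = c *\<^sub>R x"
    using assms by (auto simp: euclidean_form_def)
  have "x \<noteq> 0" using x(1) by (metis less_irrefl zero_index)
  define q where "q = x \<bullet> x"
  have q: "q > 0" using \<open>x \<noteq> 0\<close> by (simp add: q_def)
  define f where "f = (\<lambda>t. G - t *\<^sub>R outer x x)"
  have symf: "transpose (f t) = f t" for t
    unfolding f_def by (intro transpose_add_scaled transpose_outer sym)
  have "(G + 1 *\<^sub>R outer x x) *v y = 0 \<Longrightarrow> y = 0" for y
  proof -
    assume "(G + 1 *\<^sub>R outer x x) *v y = 0"
    then have "form (G + 1 *\<^sub>R outer x x) y y = 0" by (simp only: form_def) simp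
    then have "form G y y + (x \<bullet> y)\<^sup>2 = 0"
      by (simp add: form_linear_matrix form_outer power2_eq_square)
    then have 0: "form G y y = 0" "x \<bullet> y = 0"
      using psd[of y] zero_le_power2[of "x \<bullet> y"] by (auto simp: add_nonneg_eq_0_iff)
    then obtain c where "y = c *\<^sub>R x" using x(3) by blast
    then show "y = 0" using 0 q by (simp add: q_def)
  qed
  then obtain P where P: "P ** (G + 1 *\<^sub>R outer x x) = mat 1"
    using matrix_left_invertible_ker by blast
  then have P': "(G + 1 *\<^sub>R outer x x) ** P = mat 1" using matrix_left_right_inverse by blast
  have symP: "transpose P = P"
  proof -
    have "transpose P ** (G + 1 *\<^sub>R outer x x) = mat 1"
      using P' transpose_add_scaled(1)[OF sym transpose_outer] by (metis matrix_transpose_mul transpose_mat)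
    then show ?thesis by (metis P' matrix_mul_assoc matrix_mul_lid matrix_mul_rid)
  qed
  have "P *v ((G + 1 *\<^sub>R outer x x) *v x) = x" by (simp only: matrix_vector_mul_assoc P) simp
  then have "q *\<^sub>R (P *v x) = x"
    unfolding matrix_scaled_mult by (simp add: x(2) q_def matrix_vector_mult_scaleR)
  then have Px: "P *v x = (1 / q) *\<^sub>R x" using q by (metis divide_inverse mult.left_neutral order_less_irrefl
        scaleR_left_imp_eq scaleR_one scaleR_scaleR right_inverse)
  have xP: "x \<bullet> (P *v y) = (x \<bullet> y) / q" for y
    using form_commute[OF symP, of x y] Px by (simp add: form_def inner_commute)
  have GP: "G *v (P *v y) = y - ((x \<bullet> y) / q) *\<^sub>R x" for y
  proof -
    have "(G + 1 *\<^sub>R outer x x) *v (P *v y) = y" by (simp only: matrix_vector_mul_assoc P') simp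
    then show ?thesis by (simp add: matrix_scaled_mult xP algebra_simps)
  qed
  \<comment> \<open>The Sherman-Morrison formula for G + x x^T - (1 + t) x x^T, simplified by P x =
    x / q and x . P x = 1.\<close>
  define H where "H = (\<lambda>t. P - ((1 + t) / (t * q * q)) *\<^sub>R outer x x)"
  have fH: "f t ** H t = mat 1" if "t > 0" for t
  proof -
    have "f t *v (H t *v y) = y" for y
    proof -
      define a where "a = x \<bullet> y"
      define w where "w = H t *v y"
      have w: "w = P *v y - ((1 + t) / (t * q * q) * a) *\<^sub>R x"
        by (simp add: w_def H_def matrix_scaled_mult a_def)
      have "G *v w = y - (a / q) *\<^sub>R x"
        by (simp add: w matrix_vector_mult_diff_distrib matrix_vector_mult_scaleR GP x(2) a_def)
      moreover have "x \<bullet> w = a / q - (1 + t) / (t * q * q) * a * q"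
        by (simp add: w inner_diff_right xP a_def q_def)
      moreover have "f t *v w = G *v w - (t * (x \<bullet> w)) *\<^sub>R x"
        by (simp add: f_def matrix_scaled_mult)
      ultimately have "f t *v w = y - (a / q) *\<^sub>R x - (t * (a / q - (1 + t) / (t * q * q) * a * q)) *\<^sub>R x"
        by simp
      also have "\<dots> = y - (a / q + t * (a / q - (1 + t) / (t * q * q) * a * q)) *\<^sub>R x"
        by (simp add: scaleR_add_left)
      also have "a / q + t * (a / q - (1 + t) / (t * q * q) * a * q) = 0"
        using that q by (simp add: field_simps)
      finally show ?thesis by (simp add: w_def)
    qed
    then show ?thesis by (simp add: matrix_eq flip: matrix_vector_mul_assoc)
  qed
  have t0: "((\<lambda>t::real. t) \<longlongrightarrow> 0) (at_right 0)" by (rule tendsto_ident_at)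
  have "\<forall>\<^sub>F t in at_right 0. P$i$j * (t * q * q) < (1 + t) * (x$i * x$j)" for i j
  proof -
    \<comment> \<open>Negativity of an entry of \<open>H t\<close>, multiplied by
      \<open>t * q * q\<close>, becomes \<open>x$i * x$j > 0\<close> at t = 0.\<close>
    have "((\<lambda>t. (1 + t) * (x$i * x$j) - P$i$j * (t * q * q)) \<longlongrightarrow> x$i * x$j) (at_right 0)"
      using t0 by (auto intro!: tendsto_eq_intros)
    then have "\<forall>\<^sub>F t in at_right 0. (1 + t) * (x$i * x$j) - P$i$j * (t * q * q) > 0"
      using x(1) by (intro order_tendstoD(1)) auto
    then show ?thesis by eventually_elim simp
  qed
  then have "\<forall>\<^sub>F t in at_right 0. \<forall>i j. P$i$j * (t * q * q) < (1 + t) * (x$i * x$j)"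
    by (simp add: eventually_all_finite)
  moreover have "\<forall>\<^sub>F t in at_right (0::real). t > 0" by (simp add: eventually_at_right_less)
  ultimately have "\<forall>\<^sub>F t in at_right 0. hyperbolic_form (f t)"
  proof eventually_elim
    case (elim t)
    show ?case
    proof (rule hyperbolic_formI[OF symf fH[OF elim(2)]])
      have "t * q * q > 0" using elim q by simp
      then show "H t$i$j < 0" for i j
        using elim(1) by (simp add: H_def outer_def pos_less_divide_eq)
      show "form (f t) y y \<ge> 0" if "x \<bullet> y = 0" for y
        using that psd by (simp add: f_def form_linear_matrix form_outer)
    qed
  qed
  moreover have "(f \<longlongrightarrow> G) (at_right 0)"
    unfolding f_def using t0 by (auto intro!: tendsto_eq_intros)
  ultimately show ?thesis by blast
qed

text \<open>
  Adding a small multiple of their sum to all vertices moves them off the light cone. On the side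
  of the Gram matrices this is congruence by the inverse of \<open>1 + t J\<close>, with \<open>J\<close> the all-ones matrix.
\<close>

lemma hyperbolic_form_approximation_nonpos_inverse:
  fixes A :: "real^'n^'n"
  assumes sym: "transpose A = A" and inv: "A ** H = mat 1" and H: "\<And>i j. H$i$j \<le> 0"
    and psd: "\<And>i y. y$i = 0 \<Longrightarrow> form A y y \<ge> 0"
  shows "\<exists>f. (f \<longlongrightarrow> A) (at_right (0::real)) \<and> (\<forall>t>0. hyperbolic_form (f t))"
proof -
  define e :: "real^'n" where "e = (\<chi> i. 1)"
  define N where "N = e \<bullet> e"
  have "N \<ge> 0" by (simp add: N_def)
  define R where "R = (\<lambda>t. mat 1 + t *\<^sub>R outer e e)"
  \<comment> \<open>The inverse of \<open>R t\<close> by the Sherman-Morrison formula;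
    \<open>N\<close> is the number of indices.\<close>
  define Q where "Q = (\<lambda>t. mat 1 - (t / (1 + t * N)) *\<^sub>R outer e e)"
  define f where "f = (\<lambda>t. transpose (Q t) ** A ** Q t)"
  have symQ: "transpose (Q t) = Q t" for t
    unfolding Q_def by (intro transpose_add_scaled transpose_outer) simp
  have symR: "transpose (R t) = R t" for t
    unfolding R_def by (intro transpose_add_scaled transpose_outer) simp
  have "hyperbolic_form (f t)" if "t > 0" for t
  proof (rule hyperbolic_formI)
    have tN: "1 + t * N > 0" using that \<open>N \<ge> 0\<close> by (simp add: add_pos_nonneg)
    have QR: "Q t ** R t = mat 1"
    proof -
      have "Q t *v (R t *v y) = y" for y
      proof -
        define a where "a = e \<bullet> y"
        have "Q t *v (R t *v y) = y + (t * a - t / (1 + t * N) * (a + t * a * N)) *\<^sub>R e"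
          by (simp add: Q_def R_def matrix_scaled_mult a_def N_def inner_add_right)
             (simp add: algebra_simps)
        also have "t * a - t / (1 + t * N) * (a + t * a * N) = 0"
          using tN by (simp add: field_simps)
        finally show ?thesis by simp
      qed
      then show ?thesis by (simp add: matrix_eq flip: matrix_vector_mul_assoc)
    qed
    have "f t ** (R t ** H ** R t) = Q t ** A ** (Q t ** R t) ** H ** R t"
      by (simp add: f_def symQ matrix_mul_assoc)
    also have "\<dots> = Q t ** (A ** H) ** R t" by (simp add: QR matrix_mul_assoc)
    finally show "f t ** (R t ** H ** R t) = mat 1" by (simp add: inv QR)
    show "(R t ** H ** R t)$i$j < 0" for i j
    proof -
      \<comment> \<open>The rows of \<open>R t\<close> have entries at least \<open>t\<close>, so
        each entry of the new inverse combines all entries of \<open>H\<close> with positive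
        weights. One nonzero entry of \<open>H\<close> suffices for strict negativity.\<close>
      define p where "p = (\<lambda>i. R t *v axis i 1)"
      have "e \<bullet> axis i 1 = 1" for i by (simp add: inner_axis e_def)
      then have "p i$k = axis i 1$k + t" for i k
        by (simp add: p_def R_def matrix_scaled_mult) (simp add: e_def)
      then have p: "p i$k > 0" for i k
        using that by (simp add: axis_def)
      have eq: "(R t ** H ** R t)$i$j = (\<Sum>k\<in>UNIV. \<Sum>l\<in>UNIV. p i$k * H$k$l * p j$l)"
        using form_matrix_mult[of "R t" H "R t" "axis i 1" "axis j 1"]
        by (simp only: form_axis symR p_def form_expand[of H])
      have le: "p i$k * H$k$l * p j$l \<le> 0" for k l
        using p[of i k] p[of j l] H[of k l] by (simp add: mult_nonneg_nonpos mult_nonpos_nonneg less_imp_le)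
      obtain k l where "H$k$l \<noteq> 0"
      proof -
        have "H \<noteq> 0"
        proof
          assume "H = 0"
          then have "(mat 1 :: real^'n^'n) = 0" using inv by (simp add: matrix_matrix_mult_def vec_eq_iff)
          then have "(mat 1 :: real^'n^'n)$i$i = 0" by simp
          then show False by (simp add: mat_def)
        qed
        then show thesis using that by (auto simp: vec_eq_iff)
      qed
      then have "H$k$l < 0" using H[of k l] by simp
      then have lt: "p i$k * H$k$l * p j$l < 0"
        using p[of i k] p[of j l] by (simp add: mult_pos_neg mult_neg_pos)
      have "(\<Sum>l\<in>UNIV. p i$k * H$k$l * p j$l) < 0"
        using le lt sum_strict_mono_ex1[of UNIV "\<lambda>l. p i$k * H$k$l * p j$l" "\<lambda>_. 0"] by auto
      moreover have "(\<Sum>l\<in>UNIV. p i$k' * H$k'$l * p j$l) \<le> 0" for k'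
        using le by (intro sum_nonpos) auto
      ultimately show ?thesis
        unfolding eq
        using sum_strict_mono_ex1[of UNIV "\<lambda>k. \<Sum>l\<in>UNIV. p i$k * H$k$l * p j$l" "\<lambda>_. 0"] by auto
    qed
    show "transpose (f t) = f t"
      by (simp add: f_def symQ sym matrix_transpose_mul matrix_mul_assoc)
    \<comment> \<open>The hyperplane is the preimage of a coordinate hyperplane under
      \<open>Q t\<close>.\<close>
    fix i :: 'n and y assume "row i (Q t) \<bullet> y = 0"
    then have "(Q t *v y)$i = 0"
      by (simp add: matrix_vector_mul_component row_def)
    then show "form (f t) y y \<ge> 0"
      unfolding f_def form_matrix_mult by (rule psd)
  qed
  moreover have "(f \<longlongrightarrow> A) (at_right 0)"
  proof -
    have t0: "((\<lambda>t::real. t) \<longlongrightarrow> 0) (at_right 0)" by (rule tendsto_ident_at)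
    have "(Q \<longlongrightarrow> mat 1) (at_right 0)"
      unfolding Q_def using t0 by (auto intro!: tendsto_eq_intros)
    then have "(f \<longlongrightarrow> mat 1 ** A ** mat 1) (at_right 0)"
      unfolding f_def symQ by (intro tendsto_matrix_mult tendsto_const)
    then show ?thesis by simp
  qed
  ultimately show ?thesis by blast
qed

subsection \<open>Adjugates of principal submatrices\<close>

text \<open>Principal minors become ordinary determinants of fixed size. Entries in rows of
  \<open>S\<close> and columns outside \<open>S\<close> are kept, yet without effect: a permutation
  contributing to the determinant fixes every index outside \<open>S\<close>.\<close>

definition restrict_rows :: "'n set \<Rightarrow> real^'n^'n \<Rightarrow> real^'n^'n" where
  "restrict_rows S A = (\<chi> i. if i \<in> S then A$i else axis i 1)"

lemma det_on_eq_det: "det_on S A = det (restrict_rows S A)"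
proof -
  let ?f = "\<lambda>p. of_int (sign p) * (\<Prod>i\<in>UNIV. restrict_rows S A $ i $ p i)"
  have "det (restrict_rows S A) = sum ?f {p. p permutes S}"
    unfolding det_def
  proof (rule sum.mono_neutral_right)
    show "{p. p permutes S} \<subseteq> {p. p permutes UNIV}"
      by (auto intro: permutes_subset)
    show "\<forall>p\<in>{p. p permutes UNIV} - {p. p permutes S}. ?f p = 0"
    proof
      fix p assume "p \<in> {p. p permutes UNIV} - {p. p permutes S}"
      then obtain i where "i \<notin> S" "p i \<noteq> i" by (auto simp: permutes_def)
      then have "restrict_rows S A $ i $ p i = 0" by (simp add: restrict_rows_def axis_def)
      then show "?f p = 0" by (auto intro: prod_zero)
    qed
  qed simp
  also have "\<dots> = det_on S A"
    unfolding det_on_def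
  proof (rule sum.cong)
    fix p assume "p \<in> {p. p permutes S}"
    then have "(\<Prod>i\<in>UNIV. restrict_rows S A $ i $ p i) = (\<Prod>i\<in>S. restrict_rows S A $ i $ p i)"
      by (intro prod.mono_neutral_right) (auto simp: restrict_rows_def permutes_not_in)
    then show "?f p = of_int (sign p) * (\<Prod>i\<in>S. A $ i $ p i)"
      by (simp add: restrict_rows_def)
  qed simp
  finally show ?thesis by simp
qed

lemma adj_on_eq_det:
  "j \<in> S \<Longrightarrow> adj_on S A i j = det (\<chi> r. if r = j then axis i 1 else restrict_rows S A $ r)"
  unfolding adj_on_def det_on_eq_det
  by (rule arg_cong[of _ _ det]) (auto simp: restrict_rows_def vec_eq_iff)

lemma sum_det_row_replaced_by_axis:
  fixes M :: "real^'n^'n"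
  shows "(\<Sum>k\<in>UNIV. c$k * det (\<chi> r. if r = j then axis k 1 else M$r)) =
    det (\<chi> r. if r = j then c else M$r)"
proof -
  have "det (\<chi> r. if r = j then c else M$r) =
      det (\<chi> r. if r = j then (\<Sum>k\<in>UNIV. c$k *s axis k 1) else M$r)"
    by (simp only: basis_expansion)
  then show ?thesis by (simp add: det_linear_row_sum det_row_mul)
qed

text \<open>The sum is the determinant after row \<open>j\<close> has been replaced by row
  \<open>r\<close>, which has two equal rows unless \<open>r = j\<close>.\<close>

lemma sum_mult_adj_on:
  assumes "r \<in> S" "j \<in> S"
  shows "(\<Sum>k\<in>S. A$r$k * adj_on S A k j) = (if r = j then det_on S A else 0)"
proof -
  let ?M = "restrict_rows S A"
  let ?d = "\<lambda>k. det (\<chi> r. if r = j then axis k 1 else ?M$r)"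
  \<comment> \<open>Row \<open>k\<close> is already the \<open>k\<close>-th unit vector and so
    coincides with the replaced row \<open>j\<close>. This extends the sum to all indices.\<close>
  have "?d k = 0" if "k \<notin> S" for k
    using that assms
    by (intro det_identical_rows[of k j]) (auto simp: row_def restrict_rows_def vec_eq_iff)
  then have "(\<Sum>k\<in>S. A$r$k * ?d k) = (\<Sum>k\<in>UNIV. A$r$k * ?d k)"
    by (intro sum.mono_neutral_left) auto
  also have "\<dots> = det (\<chi> r'. if r' = j then A$r else ?M$r')"
    by (rule sum_det_row_replaced_by_axis)
  also have "\<dots> = (if r = j then det_on S A else 0)"
  proof (cases "r = j")
    case True
    then have "(\<chi> r'. if r' = j then A$r else ?M$r') = ?M"
      using assms by (auto simp: vec_eq_iff restrict_rows_def)
    then show ?thesis using True by (simp add: det_on_eq_det)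
  next
    case False
    then show ?thesis
      using assms by (simp, intro det_identical_rows[of r j]) (auto simp: row_def restrict_rows_def vec_eq_iff)
  qed
  finally show ?thesis using assms(2) by (simp add: adj_on_eq_det)
qed

text \<open>Cramer's rule: the \<open>i\<close>-th unit vector is the combination of the rows of
  \<open>A\<close> with coefficients from row \<open>i\<close> of \<open>H\<close>.\<close>

lemma adj_on_UNIV_eq_inverse:
  fixes A :: "real^'n^'n"
  assumes "A ** H = mat 1"
  shows "adj_on UNIV A i j = det A * H$i$j"
proof -
  have "H ** A = mat 1" using assms matrix_left_right_inverse by blast
  then have "(\<Sum>k\<in>UNIV. H$i$k * A$k$l) = (if i = l then 1 else 0)" for l
    by (simp add: vec_eq_iff matrix_matrix_mult_def mat_def)
  then have "(\<Sum>k\<in>UNIV. H$i$k *s A$k) = axis i 1"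
    by (auto simp: vec_eq_iff axis_def)
  moreover have "row k A = A$k" for k by (simp add: row_def)
  ultimately show ?thesis
    using cramer_lemma_transpose[of j "H$i" A]
    by (simp add: adj_on_def det_on_UNIV mult.commute cong: if_cong)
qed

lemma det_zero_iff_kernel: "det M = 0 \<longleftrightarrow> (\<exists>y. y \<noteq> 0 \<and> M *v y = 0)"
  for M :: "real^'n^'n"
  using matrix_left_invertible_ker[of M] invertible_det_nz[of M] invertible_left_inverse[of M] by blast

text \<open>Along the segment from the identity to \<open>M\<close> the determinant starts at 1; a
  zero at parameter t would give \<open>M\<close> the eigenvalue -(1 - t)/t. Symmetry of
  \<open>M\<close> is not assumed because \<open>restrict_rows\<close> destroys it.\<close>

lemma det_pos_if_no_nonpos_eigenvalue:
  fixes M :: "real^'n^'n"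
  assumes "\<And>s y. s \<le> 0 \<Longrightarrow> M *v y = s *\<^sub>R y \<Longrightarrow> y = 0"
  shows "det M > 0"
proof (rule ccontr)
  assume "\<not> det M > 0"
  define \<phi> where "\<phi> = (\<lambda>t. det ((1 - t) *\<^sub>R mat 1 + t *\<^sub>R M))"
  have "continuous_on {0..1} \<phi>"
    unfolding \<phi>_def continuous_on_def
    by (intro ballI tendsto_det tendsto_intros)
  moreover have "\<phi> 0 = 1" "\<phi> 1 = det M" by (simp_all add: \<phi>_def)
  ultimately obtain t where t: "0 \<le> t" "t \<le> 1" "\<phi> t = 0"
    using IVT2'[of \<phi> 1 0 0] \<open>\<not> det M > 0\<close> by auto
  then obtain y where y: "y \<noteq> 0" "((1 - t) *\<^sub>R mat 1 + t *\<^sub>R M) *v y = 0"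
    unfolding \<phi>_def det_zero_iff_kernel by blast
  have "t \<noteq> 0" using t(3) \<open>\<phi> 0 = 1\<close> by auto
  have "(1 - t) *\<^sub>R y + t *\<^sub>R (M *v y) = 0"
    using y(2) by (simp only: matrix_scaled_mult) (simp add: scaleR_matrix_vector_assoc[symmetric])
  then have eq: "t *\<^sub>R (M *v y) = - ((1 - t) *\<^sub>R y)"
    by (metis add.commute eq_neg_iff_add_eq_0)
  have "M *v y = (1 / t) *\<^sub>R (t *\<^sub>R (M *v y))" using \<open>t \<noteq> 0\<close> by simp
  also have "\<dots> = (- ((1 - t) / t)) *\<^sub>R y" unfolding eq by simp
  finally have "M *v y = (- ((1 - t) / t)) *\<^sub>R y" .
  moreover have "- ((1 - t) / t) \<le> 0" using t by simp
  ultimately show False using assms y(1) by blast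
qed

text \<open>
  For semidefinite \<open>A\<close> and a nonnegative kernel vector of minimal support \<open>S\<close>, the kernel of the
  principal submatrix on \<open>S\<close> is one-dimensional, so that each column of the adjugate is a
  multiple of that vector; the sign is given by the diagonal entry, a positive principal minor.
\<close>

lemma nonneg_kernel_iff_adjugate:
  fixes A :: "real^'n^'n"
  assumes sym: "transpose A = A" and psd: "\<And>y. form A y y \<ge> 0"
  shows "nonneg_kernel A \<longleftrightarrow>
    (\<exists>S. S \<noteq> {} \<and> det_on S A = 0 \<and> (\<forall>i\<in>S. \<forall>j\<in>S. adj_on S A i j \<ge> 0) \<and>
      (\<exists>i\<in>S. \<exists>j\<in>S. adj_on S A i j \<noteq> 0))" (is "_ \<longleftrightarrow> ?R")
proof -
  have column: "A *v (\<chi> k. if k \<in> S then adj_on S A k j else 0) = 0"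
    if "det_on S A = 0" "j \<in> S" for S j
  proof -
    define a where "a = (\<chi> k. if k \<in> S then adj_on S A k j else 0)"
    have "(A *v a)$r = 0" if "r \<in> S" for r
    proof -
      have "(A *v a)$r = (\<Sum>k\<in>S. A$r$k * adj_on S A k j)"
        unfolding matrix_vector_mult_def a_def by (simp add: if_distrib sum.If_cases cong: if_cong)
      then show ?thesis
        using sum_mult_adj_on[OF that \<open>j \<in> S\<close>, of A] \<open>det_on S A = 0\<close> by simp
    qed
    moreover have "a$r = 0" if "r \<notin> S" for r using that by (simp add: a_def)
    \<comment> \<open>Inside \<open>S\<close> the second factor vanishes, outside \<open>S\<close>
      the first. Semidefiniteness then makes \<open>A *v a\<close> vanish also in the rows outside
      \<open>S\<close>.\<close>
    ultimately have "a$r * (A *v a)$r = 0" for r by (metis mult_eq_0_iff)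
    then have "form A a a = 0"
      unfolding form_def inner_vec_def by (intro sum.neutral) simp
    then show ?thesis
      using psd_form_zero[OF sym psd, of a] by (simp add: a_def)
  qed
  show ?thesis
  proof
    assume ?R
    then obtain S i j where S: "det_on S A = 0" "\<And>i j. i \<in> S \<Longrightarrow> j \<in> S \<Longrightarrow> adj_on S A i j \<ge> 0"
      and ij: "i \<in> S" "j \<in> S" "adj_on S A i j \<noteq> 0"
      by blast
    define a :: "real^'n" where "a = (\<chi> k. if k \<in> S then adj_on S A k j else 0)"
    have "a$i \<noteq> 0" using ij by (simp add: a_def)
    then have "a \<noteq> 0" by auto
    moreover have "a$k \<ge> 0" for k using S(2) ij by (simp add: a_def)
    ultimately show "nonneg_kernel A"
      using column[OF S(1) ij(2), folded a_def] unfolding nonneg_kernel_def by blast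
  next
    define P where "P = (\<lambda>x::real^'n. (\<forall>i. x$i \<ge> 0) \<and> x \<noteq> 0 \<and> A *v x = 0)"
    assume "nonneg_kernel A"
    then obtain x0 where "P x0" by (auto simp: nonneg_kernel_def P_def)
    then obtain x where x: "P x" and least: "\<And>y. P y \<Longrightarrow> card {i. x$i \<noteq> 0} \<le> card {i. y$i \<noteq> 0}"
      using ex_has_least_nat[of P x0 "\<lambda>x. card {i. x$i \<noteq> 0}"] by blast
    define S where "S = {i. x$i \<noteq> 0}"
    have x0: "x$i \<ge> 0" "A *v x = 0" "x \<noteq> 0" for i using x by (auto simp: P_def)
    have xpos: "x$i > 0" if "i \<in> S" for i using x0(1)[of i] that by (simp add: S_def)
    have "S \<noteq> {}" using x0(3) by (auto simp: S_def vec_eq_iff)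
    have kernel: "\<exists>c. y = c *\<^sub>R x" if Ay: "A *v y = 0" and supp: "\<And>i. i \<notin> S \<Longrightarrow> y$i = 0" for y
    proof -
      \<comment> \<open>With the largest ratio, \<open>c *\<^sub>R x - y\<close> is nonnegative and
        loses an index of \<open>S\<close> from its support, so minimality of the support forces it
        to be 0.\<close>
      define c where "c = Max ((\<lambda>i. y$i / x$i) ` S)"
      have "c \<in> (\<lambda>i. y$i / x$i) ` S"
        unfolding c_def using \<open>S \<noteq> {}\<close> by (intro Max_in) auto
      then obtain i where i: "i \<in> S" "c = y$i / x$i" by blast
      define z where "z = c *\<^sub>R x - y"
      have zi: "z$i = 0" using i xpos[of i] by (simp add: z_def)
      have zS: "z$k = 0" if "k \<notin> S" for k using that supp by (simp add: z_def S_def)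
      have "z$k \<ge> 0" for k
      proof (cases "k \<in> S")
        case True
        then have "y$k / x$k \<le> c" unfolding c_def by (intro Max_ge) auto
        then show ?thesis using xpos[OF True] by (simp add: z_def pos_divide_le_eq)
      qed (simp add: zS)
      moreover have "A *v z = 0"
        by (simp add: z_def matrix_vector_mult_diff_distrib matrix_vector_mult_scaleR Ay x0)
      moreover have "card {k. z$k \<noteq> 0} < card S"
      proof (rule psubset_card_mono)
        show "{k. z$k \<noteq> 0} \<subset> S" using zS zi i(1) by blast
      qed simp
      ultimately have "z = 0" using least[of z] by (auto simp: P_def S_def)
      then show ?thesis by (auto simp: z_def)
    qed
    have det0: "det_on S A = 0"
    proof -
      have "(restrict_rows S A *v x)$i = 0" for i
      proof (cases "i \<in> S")
        case True
        then have "(restrict_rows S A *v x)$i = (A *v x)$i"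
          by (simp add: restrict_rows_def matrix_vector_mul_component)
        then show ?thesis using x0 by simp
      next
        case False
        then show ?thesis
          by (simp add: restrict_rows_def matrix_vector_mul_component inner_axis' S_def)
      qed
      then have "restrict_rows S A *v x = 0" by (simp add: vec_eq_iff)
      then show ?thesis using x0(3) by (auto simp: det_on_eq_det det_zero_iff_kernel)
    qed
    have adj_diag: "adj_on S A j j > 0" if "j \<in> S" for j
    proof -
      \<comment> \<open>The diagonal cofactor is the principal minor on \<open>T\<close>. An
        eigenvector to a nonpositive eigenvalue is supported on \<open>T\<close> and lies in the
        kernel of \<open>A\<close>, hence is a multiple of \<open>x\<close> vanishing at
        \<open>j\<close>.\<close>
      define T where "T = S - {j}"
      have "(\<chi> r. if r = j then axis j 1 else restrict_rows S A $ r) = restrict_rows T A"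
        by (auto simp: vec_eq_iff restrict_rows_def T_def)
      moreover have "det (restrict_rows T A) > 0"
      proof (rule det_pos_if_no_nonpos_eigenvalue)
        fix s :: real and y
        assume s: "s \<le> 0" and eq: "restrict_rows T A *v y = s *\<^sub>R y"
        have row: "(restrict_rows T A *v y)$i = s * y$i" for i by (simp add: eq)
        have out: "y$i = 0" if "i \<notin> T" for i
        proof -
          have "y$i = s * y$i"
            using row[of i] that by (simp add: restrict_rows_def matrix_vector_mul_component inner_axis')
          then have "(1 - s) * y$i = 0" by (simp add: algebra_simps)
          then show ?thesis using s by simp
        qed
        have "(A *v y)$i = s * y$i" if "i \<in> T" for i
          using row[of i] that by (simp add: restrict_rows_def matrix_vector_mul_component)
        then have "y$i * (A *v y)$i = s * (y$i * y$i)" for i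
          using out[of i] by (cases "i \<in> T") auto
        then have "form A y y = s * (y \<bullet> y)"
          unfolding form_def inner_vec_def inner_real_def sum_distrib_left by (rule sum.cong[OF refl])
        then have "form A y y \<le> 0" using s by (simp add: mult_nonpos_nonneg)
        then have "A *v y = 0" by (rule psd_form_zero[OF sym psd])
        then obtain c where c: "y = c *\<^sub>R x"
          using kernel[of y] out by (auto simp: T_def)
        have "y$j = 0" by (rule out) (simp add: T_def)
        then show "y = 0" using c xpos[OF \<open>j \<in> S\<close>] by simp
      qed
      ultimately show ?thesis using adj_on_eq_det[OF that, of A j] by simp
    qed
    have "adj_on S A i j \<ge> 0" if "i \<in> S" "j \<in> S" for i j
    proof -
      define a :: "real^'n" where "a = (\<chi> k. if k \<in> S then adj_on S A k j else 0)"
      obtain c where c: "a = c *\<^sub>R x"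
        using kernel[of a] column[OF det0 \<open>j \<in> S\<close>] by (auto simp: a_def)
      \<comment> \<open>The diagonal cofactor at \<open>j\<close> fixes the sign of the whole
        column.\<close>
      have "c * x$j > 0" using adj_diag[OF \<open>j \<in> S\<close>] \<open>j \<in> S\<close> c by (simp add: a_def vec_eq_iff) metis
      then have "c > 0" using xpos[OF \<open>j \<in> S\<close>] by (simp add: zero_less_mult_iff)
      moreover have "adj_on S A i j = c * x$i" using c \<open>i \<in> S\<close> by (simp add: a_def vec_eq_iff) metis
      ultimately show ?thesis using x0(1)[of i] by simp
    qed
    moreover have "\<exists>i\<in>S. \<exists>j\<in>S. adj_on S A i j \<noteq> 0"
      using adj_diag \<open>S \<noteq> {}\<close> by (metis ex_in_conv less_irrefl)
    ultimately show ?R using det0 \<open>S \<noteq> {}\<close> by blast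
  qed
qed

section \<open>Semidefiniteness of principal submatrices\<close>

lemma psd_on_UNIV_iff: "psd_on UNIV A \<longleftrightarrow> (\<forall>y. form A y y \<ge> 0)"
proof
  assume psd: "psd_on UNIV A"
  show "\<forall>y. form A y y \<ge> 0"
    unfolding form_expand using psd by (simp add: psd_on_def)
next
  assume psd: "\<forall>y. form A y y \<ge> 0"
  show "psd_on UNIV A"
    unfolding psd_on_def
  proof
    fix x :: "'a \<Rightarrow> real"
    show "(\<Sum>i\<in>UNIV. \<Sum>j\<in>UNIV. x i * A$i$j * x j) \<ge> 0"
      using psd[rule_format, of "\<chi> i. x i"] by (simp add: form_expand)
  qed
qed

lemma psd_on_codim_1_iff:
  fixes A :: "real^('m::finite option)^('m option)"
  shows "(\<forall>S. card S = CARD('m) \<longrightarrow> psd_on S A) \<longleftrightarrow> (\<forall>i y. y$i = 0 \<longrightarrow> form A y y \<ge> 0)"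
proof -
  have minor: "psd_on (- {i}) A \<longleftrightarrow> (\<forall>y. y$i = 0 \<longrightarrow> form A y y \<ge> 0)" for i
  proof -
    have sum: "(\<Sum>k\<in>UNIV. \<Sum>l\<in>UNIV. y k * A$k$l * y l) = (\<Sum>k\<in>- {i}. \<Sum>l\<in>- {i}. y k * A$k$l * y l)"
      if "y i = 0" for y
    proof -
      have "(\<Sum>k\<in>UNIV. \<Sum>l\<in>UNIV. y k * A$k$l * y l) = (\<Sum>k\<in>- {i}. \<Sum>l\<in>UNIV. y k * A$k$l * y l)"
        by (rule sum_neutral_complement) (use that in auto)
      also have "\<dots> = (\<Sum>k\<in>- {i}. \<Sum>l\<in>- {i}. y k * A$k$l * y l)"
        by (intro sum.cong refl sum_neutral_complement) (use that in auto)
      finally show ?thesis .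
    qed
    show ?thesis
    proof
      assume psd: "psd_on (- {i}) A"
      show "\<forall>y. y$i = 0 \<longrightarrow> form A y y \<ge> 0"
        using psd by (auto simp: form_expand sum psd_on_def)
    next
      assume psd: "\<forall>y. y$i = 0 \<longrightarrow> form A y y \<ge> 0"
      show "psd_on (- {i}) A"
        unfolding psd_on_def
      proof
        fix x :: "'m option \<Rightarrow> real"
        define y where "y = (\<lambda>k. if k = i then 0 else x k)"
        have "form A (\<chi> k. y k) (\<chi> k. y k) \<ge> 0" using psd by (simp add: y_def)
        then have "(\<Sum>k\<in>- {i}. \<Sum>l\<in>- {i}. y k * A$k$l * y l) \<ge> 0"
          using sum[of y] by (simp add: form_expand y_def)
        moreover have "(\<Sum>k\<in>- {i}. \<Sum>l\<in>- {i}. y k * A$k$l * y l) =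
            (\<Sum>k\<in>- {i}. \<Sum>l\<in>- {i}. x k * A$k$l * x l)"
          by (intro sum.cong refl) (simp add: y_def)
        ultimately show "(\<Sum>k\<in>- {i}. \<Sum>l\<in>- {i}. x k * A$k$l * x l) \<ge> 0" by simp
      qed
    qed
  qed
  have "card S = CARD('m) \<longleftrightarrow> (\<exists>i. S = - {i})" for S :: "'m option set"
  proof
    assume "card S = CARD('m)"
    then have "card (- S) = 1"
      by (simp add: card_UNIV_option Compl_eq_Diff_UNIV card_Diff_subset)
    then obtain i where "- S = {i}" by (rule card_1_singletonE)
    then show "\<exists>i. S = - {i}" by (metis double_complement)
  next
    assume "\<exists>i. S = - {i}"
    then show "card S = CARD('m)"
      by (auto simp: Compl_eq_Diff_UNIV card_Diff_subset card_UNIV_option)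
  qed
  then show ?thesis using minor by auto
qed

subsection \<open>Closures\<close>

text \<open>The weak inequality covers two cases at once: Euclidean matrices vanish on a positive
  vector, hyperbolic ones are negative on the columns of the negated inverse. Unit length keeps the
  limit vector from being 0.\<close>

lemma closed_nonneg_nonpos_direction:
  "closed {A :: real^'n^'n. \<exists>x. (\<forall>i. x$i \<ge> 0) \<and> x \<noteq> 0 \<and> form A x x \<le> 0}" (is "closed ?C")
  unfolding closed_sequential_limits
proof (intro allI impI, elim conjE)
  fix A :: "nat \<Rightarrow> real^'n^'n" and L
  assume A: "\<forall>n. A n \<in> ?C" and lim: "A \<longlonglongrightarrow> L"
  have "\<exists>x. (\<forall>i. x$i \<ge> 0) \<and> norm x = 1 \<and> form (A n) x x \<le> 0" for n
  proof -
    obtain x where x: "\<And>i. x$i \<ge> 0" "x \<noteq> 0" "form (A n) x x \<le> 0" using A by blast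
    define y where "y = (1 / norm x) *\<^sub>R x"
    have "form (A n) y y \<le> 0"
      using x by (simp add: y_def divide_nonpos_nonneg)
    moreover have "norm y = 1" "\<And>i. y$i \<ge> 0" using x by (simp_all add: y_def)
    ultimately show ?thesis by blast
  qed
  then obtain x where x: "\<And>n i. x n$i \<ge> 0" "\<And>n. norm (x n) = 1" "\<And>n. form (A n) (x n) (x n) \<le> 0"
    by metis
  have "\<forall>n. x n \<in> sphere 0 1" using x(2) by simp
  then obtain l r where l: "l \<in> sphere 0 1" "strict_mono r" "(x \<circ> r) \<longlonglongrightarrow> l"
    using compact_sphere[of "0 :: real^'n" 1] unfolding compact_def by metis
  have "form L l l \<le> 0"
  proof (rule LIMSEQ_le_const2)
    show "(\<lambda>n. form ((A \<circ> r) n) ((x \<circ> r) n) ((x \<circ> r) n)) \<longlonglongrightarrow> form L l l"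
      by (intro tendsto_form l(3) LIMSEQ_subseq_LIMSEQ[OF lim l(2)])
    show "\<exists>N. \<forall>n\<ge>N. form ((A \<circ> r) n) ((x \<circ> r) n) ((x \<circ> r) n) \<le> 0" using x(3) by simp
  qed
  moreover have "l$i \<ge> 0" for i
    by (rule LIMSEQ_le_const[OF tendsto_vec_nth[OF l(3)]]) (use x(1) in auto)
  moreover have "l \<noteq> 0" using l(1) by auto
  ultimately show "L \<in> ?C" by blast
qed

lemma closed_form_nonneg: "closed {A :: real^'n^'n. form A y y \<ge> 0}"
  by (intro closed_Collect_le continuous_on_const)
     (auto simp: continuous_on_def intro!: tendsto_form tendsto_ident_at)

lemma closed_det_nonpos: "closed {A :: real^'n^'n. det A \<le> 0}"
  by (intro closed_Collect_le continuous_on_const)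
     (auto simp: continuous_on_def intro!: tendsto_det tendsto_ident_at)

lemma closed_adj_on_UNIV_nonneg: "closed {A :: real^'n^'n. adj_on UNIV A i j \<ge> 0}"
  by (intro closed_Collect_le continuous_on_const)
     (auto simp: continuous_on_def intro!: tendsto_adj_on_UNIV tendsto_ident_at)

lemma closure_spherical_form_iff:
  fixes A :: "real^'n^'n"
  assumes card: "CARD('n) \<ge> 3" and sym: "transpose A = A" and unit: "\<And>i. A$i$i = 1"
  shows "A \<in> closure {A. spherical_form A \<and> (\<forall>i. A$i$i = 1)} \<longleftrightarrow> (\<forall>y. form A y y \<ge> 0)"
    (is "_ \<in> closure ?X \<longleftrightarrow> _")
proof
  assume A: "A \<in> closure ?X"
  show "\<forall>y. form A y y \<ge> 0"
  proof
    fix y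
    have "form B y y \<ge> 0" if "B \<in> ?X" for B
      using that by (cases "y = 0") (auto simp: spherical_form_def less_imp_le)
    then have "closure ?X \<subseteq> {B. form B y y \<ge> 0}"
      by (intro closure_minimal closed_form_nonneg) auto
    then show "form A y y \<ge> 0" using A by auto
  qed
next
  assume psd: "\<forall>y. form A y y \<ge> 0"
  define f where "f = (\<lambda>t. A + t *\<^sub>R mat 1)"
  have "spherical_form (f t)" if "t > 0" for t
    using that psd transpose_add_scaled(1)[OF sym transpose_mat]
    by (simp add: spherical_form_def f_def form_linear_matrix add_nonneg_pos)
  then have "\<forall>\<^sub>F t in at_right 0. unit_diag (f t) \<in> ?X"
    using unit_diag_forms(1)[OF card] by (auto intro: eventually_at_rightI[of 0 1])
  moreover have "(f \<longlongrightarrow> A) (at_right 0)"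
    unfolding f_def by (auto intro!: tendsto_eq_intros)
  ultimately show "A \<in> closure ?X"
    using unit by (intro closure_if_unit_diag_tendsto)
qed

lemma closure_euclidean_form_iff:
  fixes A :: "real^'n^'n"
  assumes card: "CARD('n) \<ge> 3" and sym: "transpose A = A" and unit: "\<And>i. A$i$i = 1"
  shows "A \<in> closure {A. euclidean_form A \<and> (\<forall>i. A$i$i = 1)} \<longleftrightarrow>
    (\<forall>y. form A y y \<ge> 0) \<and> nonneg_kernel A" (is "_ \<in> closure ?Z \<longleftrightarrow> _")
proof
  assume A: "A \<in> closure ?Z"
  have psd: "\<forall>y. form A y y \<ge> 0"
  proof
    fix y
    have "closure ?Z \<subseteq> {B. form B y y \<ge> 0}"
      by (intro closure_minimal closed_form_nonneg) (auto simp: euclidean_form_def)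
    then show "form A y y \<ge> 0" using A by auto
  qed
  have "\<exists>x. (\<forall>i. x$i \<ge> 0) \<and> x \<noteq> 0 \<and> form B x x \<le> 0" if B: "B \<in> ?Z" for B
  proof -
    obtain x where "\<And>i. x$i > 0" "B *v x = 0" using B by (auto simp: euclidean_form_def)
    then show ?thesis
      by (intro exI[of _ x]) (auto simp: form_def less_imp_le dest: less_imp_neq)
  qed
  then have "closure ?Z \<subseteq> {A. \<exists>x. (\<forall>i. x$i \<ge> 0) \<and> x \<noteq> 0 \<and> form A x x \<le> 0}"
    by (intro closure_minimal closed_nonneg_nonpos_direction) blast
  then obtain x where "\<And>i. x$i \<ge> 0" "x \<noteq> 0" "form A x x \<le> 0" using A by blast
  then have "nonneg_kernel A"
    using psd_form_zero[OF sym] psd unfolding nonneg_kernel_def by blast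
  then show "(\<forall>y. form A y y \<ge> 0) \<and> nonneg_kernel A" using psd by blast
next
  assume "(\<forall>y. form A y y \<ge> 0) \<and> nonneg_kernel A"
  then obtain f where f: "(f \<longlongrightarrow> A) (at_right (0::real))" "\<And>t. t > 0 \<Longrightarrow> euclidean_form (f t)"
    using euclidean_form_approximation[OF sym] by blast
  have "\<forall>\<^sub>F t in at_right 0. unit_diag (f t) \<in> ?Z"
    using unit_diag_forms(2)[OF card] f(2) by (auto intro: eventually_at_rightI[of 0 1])
  then show "A \<in> closure ?Z"
    using f(1) unit by (intro closure_if_unit_diag_tendsto)
qed

text \<open>Subtracting a multiple of a kernel vector does not change the form and can bring one
  coordinate to 0.\<close>

lemma psd_if_minors_psd_singular:
  fixes A :: "real^'n^'n"
  assumes sym: "transpose A = A" and det: "det A = 0"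
    and minors: "\<And>i y. y$i = 0 \<Longrightarrow> form A y y \<ge> 0"
  shows "form A y y \<ge> 0"
proof -
  obtain z where z: "z \<noteq> 0" "A *v z = 0" using det by (auto simp: det_zero_iff_kernel)
  then obtain i where i: "z$i \<noteq> 0" by (auto simp: vec_eq_iff)
  define c where "c = y$i / z$i"
  have "form A (y - c *\<^sub>R z) (y - c *\<^sub>R z) \<ge> 0"
    using i by (intro minors[of _ i]) (simp add: c_def)
  moreover have "form A w z = 0" "form A z w = 0" for w
    using z form_commute[OF sym, of z w] by (simp_all add: form_def)
  ultimately show ?thesis by simp
qed

lemma closure_hyperbolic_form_iff:
  fixes A :: "real^('m::finite option)^('m option)"
  assumes card: "CARD('m option) \<ge> 3" and sym: "transpose A = A" and unit: "\<And>i. A$i$i = 1"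
  shows "A \<in> closure {A. hyperbolic_form A \<and> (\<forall>i. A$i$i = 1)} \<longleftrightarrow>
    A \<in> closure {A. euclidean_form A \<and> (\<forall>i. A$i$i = 1)} \<or>
    det A < 0 \<and> (\<forall>i j. adj_on UNIV A i j \<ge> 0) \<and> (\<forall>i y. y$i = 0 \<longrightarrow> form A y y \<ge> 0)"
    (is "_ \<in> closure ?Y \<longleftrightarrow> _ \<in> closure ?Z \<or> ?R")
proof
  assume A: "A \<in> closure ?Y"
  have minors: "form A y y \<ge> 0" if "y$i = 0" for y i
  proof -
    have "form B y y \<ge> 0" if "B \<in> ?Y" for B
      using that \<open>y$i = 0\<close> by (cases "y = 0") (auto simp: hyperbolic_form_def intro: less_imp_le)
    then have "closure ?Y \<subseteq> {B. form B y y \<ge> 0}"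
      by (intro closure_minimal closed_form_nonneg) auto
    then show ?thesis using A by auto
  qed
  have "closure ?Y \<subseteq> {B. det B \<le> 0}"
    by (intro closure_minimal closed_det_nonpos) (auto dest: hyperbolic_form_det_neg intro: less_imp_le)
  then have det: "det A \<le> 0" using A by auto
  show "A \<in> closure ?Z \<or> ?R"
  proof (cases "det A = 0")
    case True
    then have psd: "form A y y \<ge> 0" for y
      using psd_if_minors_psd_singular[OF sym] minors by blast
    have "\<exists>x. (\<forall>i. x$i \<ge> 0) \<and> x \<noteq> 0 \<and> form B x x \<le> 0" if B: "B \<in> ?Y" for B
    proof -
      obtain H where H: "B ** H = mat 1" "\<And>i j. H$i$j < 0"
        using B by (auto simp: hyperbolic_form_def)
      define h where "h = H *v axis None 1"
      have h: "h$i = H$i$None" for i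
        by (simp add: h_def matrix_vector_mult_basis column_def)
      \<comment> \<open>A positive multiple of a vertex in normal coordinates, up to sign: the
        negated column of the inverse is a positive vector on which the form is negative.\<close>
      define x where "x = (-1) *\<^sub>R h"
      have "B *v h = axis None 1"
        by (simp add: h_def matrix_vector_mul_assoc H(1))
      then have "form B h h = H$None$None"
        by (simp add: form_def inner_axis h)
      then have "form B x x = H$None$None"
        by (simp only: x_def form_linear)
      moreover have "x$i > 0" for i using H(2) by (simp add: x_def h)
      ultimately show ?thesis
        using H(2)[of None None]
        by (intro exI[of _ x]) (auto simp: less_imp_le dest: less_imp_neq)
    qed
    then have "closure ?Y \<subseteq> {A. \<exists>x. (\<forall>i. x$i \<ge> 0) \<and> x \<noteq> 0 \<and> form A x x \<le> 0}"
      by (intro closure_minimal closed_nonneg_nonpos_direction) blast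
    then obtain x where "\<And>i. x$i \<ge> 0" "x \<noteq> 0" "form A x x \<le> 0" using A by blast
    then have "nonneg_kernel A"
      using psd_form_zero[OF sym psd] unfolding nonneg_kernel_def by blast
    then show ?thesis
      using psd closure_euclidean_form_iff[OF card sym unit] by blast
  next
    case False
    have "adj_on UNIV A i j \<ge> 0" for i j
    proof -
      have "adj_on UNIV B i j \<ge> 0" if B: "B \<in> ?Y" for B
      proof -
        obtain H where "B ** H = mat 1" "\<And>i j. H$i$j < 0"
          using B by (auto simp: hyperbolic_form_def)
        then show ?thesis
          using hyperbolic_form_det_neg[of B] B
          by (simp add: adj_on_UNIV_eq_inverse mult_nonpos_nonpos less_imp_le)
      qed
      then have "closure ?Y \<subseteq> {B. adj_on UNIV B i j \<ge> 0}"
        by (intro closure_minimal closed_adj_on_UNIV_nonneg) auto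
      then show ?thesis using A by auto
    qed
    then show ?thesis using False det minors by auto
  qed
next
  assume "A \<in> closure ?Z \<or> ?R"
  then show "A \<in> closure ?Y"
  proof
    \<comment> \<open>It is enough to approximate genuine Euclidean matrices; their limits follow
      since a closure is closed.\<close>
    have "B \<in> closure ?Y" if B: "B \<in> ?Z" for B
    proof -
      obtain f where f: "(f \<longlongrightarrow> B) (at_right (0::real))" "\<forall>\<^sub>F t in at_right 0. hyperbolic_form (f t)"
        using hyperbolic_form_approximation_euclidean B by blast
      from f(2) have "\<forall>\<^sub>F t in at_right 0. unit_diag (f t) \<in> ?Y"
        by eventually_elim (use unit_diag_forms(3)[OF card] in auto)
      then show ?thesis
        using f(1) B by (intro closure_if_unit_diag_tendsto) auto
    qed
    then have "closure ?Z \<subseteq> closure ?Y" by (intro closure_minimal) auto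
    then show "A \<in> closure ?Y" if "A \<in> closure ?Z" using that by blast
  next
    assume R: ?R
    then have "invertible A" by (simp add: invertible_det_nz)
    then obtain H where H: "A ** H = mat 1" by (auto simp: invertible_def)
    have "H$i$j \<le> 0" for i j
      using R adj_on_UNIV_eq_inverse[OF H, of i j] by (metis mult_neg_pos not_le)
    then obtain f where f: "(f \<longlongrightarrow> A) (at_right (0::real))" "\<And>t. t > 0 \<Longrightarrow> hyperbolic_form (f t)"
      using hyperbolic_form_approximation_nonpos_inverse[OF sym H] R by blast
    have "\<forall>\<^sub>F t in at_right 0. unit_diag (f t) \<in> ?Y"
      using unit_diag_forms(3)[OF card] f(2) by (auto intro: eventually_at_rightI[of 0 1])
    then show "A \<in> closure ?Y"
      using f(1) unit by (intro closure_if_unit_diag_tendsto)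
  qed
qed

section \<open>Sign changes and the three characterisations\<close>

lemma diag_mult_eq_diag_scale: "diag \<epsilon> ** A ** diag \<epsilon> = diag_scale \<epsilon> A"
proof -
  have "transpose (diag \<epsilon>) = diag \<epsilon>" by (rule transpose_eqI) (simp add: diag_def)
  moreover have "diag \<epsilon> *v axis i 1 = \<epsilon> i *\<^sub>R axis i 1" for i
    by (simp add: matrix_vector_mult_basis) (auto simp: vec_eq_iff column_def diag_def axis_def)
  ultimately have "(diag \<epsilon> ** A ** diag \<epsilon>)$i$j = \<epsilon> i * \<epsilon> j * A$i$j" for i j
    using form_matrix_mult[of "diag \<epsilon>" A "diag \<epsilon>" "axis i 1" "axis j 1"]
    by (simp add: form_axis mult.assoc)
  then show ?thesis by (simp add: vec_eq_iff diag_scale_def)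
qed

theorem theorem3:
  fixes A :: "real^('m::finite option)^('m option)"
  assumes "CARD('m) \<ge> 2"
    and "transpose A = A"
    and "\<And>i. A $ i $ i = 1"
  shows
    "(A \<in> closure euclidean_grams \<longleftrightarrow>
        det A = 0 \<and> psd_on UNIV A \<and>
        (\<exists>k S. k \<le> CARD('m) \<and> card S = k + 1 \<and> det_on S A = 0 \<and>
           (\<forall>i\<in>S. \<forall>j\<in>S. adj_on S A i j \<ge> 0) \<and>
           (\<exists>i\<in>S. \<exists>j\<in>S. adj_on S A i j \<noteq> 0)))
     \<and>
     (A \<in> closure spherical_grams \<longleftrightarrow>
        A \<in> spherical_grams \<or>
        (\<exists>\<epsilon>. (\<forall>i. \<epsilon> i \<in> {1, -1}) \<and> diag \<epsilon> ** A ** diag \<epsilon> \<in> closure euclidean_grams))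
     \<and>
     (A \<in> closure hyperbolic_grams \<longleftrightarrow>
        A \<in> closure euclidean_grams \<or>
        (det A < 0 \<and> (\<forall>i j. adj_on UNIV A i j \<ge> 0) \<and>
         (\<forall>S. card S = CARD('m) \<longrightarrow> psd_on S A)))"
proof (intro conjI)
  note card = card_option_ge_3[OF assms(1)] and sym = assms(2) and unit = assms(3)
  note euclidean = closure_euclidean_form_iff[OF card, folded euclidean_grams_eq[OF assms(1)]]
  note spherical = closure_spherical_form_iff[OF card, folded spherical_grams_eq[OF assms(1)]]
  show "A \<in> closure euclidean_grams \<longleftrightarrow>
        det A = 0 \<and> psd_on UNIV A \<and>
        (\<exists>k S. k \<le> CARD('m) \<and> card S = k + 1 \<and> det_on S A = 0 \<and>
           (\<forall>i\<in>S. \<forall>j\<in>S. adj_on S A i j \<ge> 0) \<and>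
           (\<exists>i\<in>S. \<exists>j\<in>S. adj_on S A i j \<noteq> 0))" (is "_ \<longleftrightarrow> _ \<and> _ \<and> ?minor")
  proof -
    \<comment> \<open>Since \<open>k\<close> starts at 0 and ends at the dimension, the size
      condition only says that \<open>S\<close> is nonempty.\<close>
    have nonempty: "(\<exists>k. k \<le> CARD('m) \<and> card S = k + 1) \<longleftrightarrow> S \<noteq> {}" for S :: "'m option set"
    proof
      assume "S \<noteq> {}"
      then have "card S > 0" by (simp add: card_gt_0_iff)
      moreover have "card S \<le> CARD('m) + 1"
        using card_mono[of UNIV S] by (simp add: card_UNIV_option)
      ultimately show "\<exists>k. k \<le> CARD('m) \<and> card S = k + 1"
        by (intro exI[of _ "card S - 1"]) auto
    qed auto
    have "(\<exists>k S. k \<le> CARD('m) \<and> card S = k + 1 \<and> R S) \<longleftrightarrow> (\<exists>S. S \<noteq> {} \<and> R S)"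
      for R :: "'m option set \<Rightarrow> bool"
      unfolding nonempty[symmetric] by blast
    then have minor: "?minor \<longleftrightarrow> nonneg_kernel A" if "\<And>y. form A y y \<ge> 0"
      unfolding nonneg_kernel_iff_adjugate[OF sym that] .
    have det: "det A = 0" if "nonneg_kernel A"
      using that by (auto simp: nonneg_kernel_def det_zero_iff_kernel)
    show ?thesis
      unfolding euclidean[OF sym unit] psd_on_UNIV_iff
    proof (intro iffI conjI; elim conjE)
      assume psd: "\<forall>y. form A y y \<ge> 0" and kernel: "nonneg_kernel A"
      show "\<forall>y. form A y y \<ge> 0" by (rule psd)
      show "det A = 0" by (rule det[OF kernel])
      show ?minor by (rule iffD2[OF minor[OF psd[rule_format]] kernel])
    next
      assume psd: "\<forall>y. form A y y \<ge> 0" and m: ?minor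
      show "\<forall>y. form A y y \<ge> 0" by (rule psd)
      show "nonneg_kernel A" by (rule iffD1[OF minor[OF psd[rule_format]] m])
    qed
  qed
  show "A \<in> closure spherical_grams \<longleftrightarrow>
        A \<in> spherical_grams \<or>
        (\<exists>\<epsilon>. (\<forall>i. \<epsilon> i \<in> {1, -1}) \<and> diag \<epsilon> ** A ** diag \<epsilon> \<in> closure euclidean_grams)"
  proof -
    \<comment> \<open>A sign change preserves semidefiniteness and the unit diagonal; it affects
      only the signs of kernel vectors.\<close>
    have signed: "diag \<epsilon> ** A ** diag \<epsilon> \<in> closure euclidean_grams \<longleftrightarrow>
        (\<forall>y. form A y y \<ge> 0) \<and> nonneg_kernel (diag_scale \<epsilon> A)"
      if \<epsilon>: "\<forall>i. \<epsilon> i \<in> {1, -1}" for \<epsilon>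
    proof -
      have sq: "\<epsilon> i * \<epsilon> i = 1" for i using \<epsilon>[rule_format, of i] by auto
      have "(\<forall>y. form (diag_scale \<epsilon> A) y y \<ge> 0) \<longleftrightarrow> (\<forall>y. form A y y \<ge> 0)"
      proof
        assume psd: "\<forall>y. form (diag_scale \<epsilon> A) y y \<ge> 0"
        show "\<forall>y. form A y y \<ge> 0"
        proof
          fix y
          show "form A y y \<ge> 0"
            using psd[rule_format, of "\<chi> i. \<epsilon> i * y$i"] sq by (simp add: form_diag_scale flip: mult.assoc)
        qed
      qed (simp add: form_diag_scale)
      moreover have "diag_scale \<epsilon> A $ i $ i = 1" for i using unit sq by (simp add: diag_scale_def)
      ultimately show ?thesis
        unfolding diag_mult_eq_diag_scale
        using euclidean[OF transpose_diag_scale[OF sym]] by blast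
    qed
    have "\<exists>\<epsilon>. (\<forall>i. \<epsilon> i \<in> {1, -1}) \<and> nonneg_kernel (diag_scale \<epsilon> A)"
      if psd: "\<forall>y. form A y y \<ge> 0" and "\<not> spherical_form A"
    proof -
      obtain x where "x \<noteq> 0" "form A x x \<le> 0"
        using \<open>\<not> spherical_form A\<close> sym by (auto simp: spherical_form_def not_less)
      then have Ax: "A *v x = 0" using psd psd_form_zero[OF sym] by blast
      \<comment> \<open>The signs of a kernel vector \<open>x\<close> of \<open>A\<close>, with zero
        entries counted as positive, so that the vector of absolute values is annihilated by the
        sign-changed matrix.\<close>
      define \<epsilon> where "\<epsilon> = (\<lambda>i. if x$i \<ge> 0 then 1 else - 1 :: real)"
      define z :: "real^('m option)" where "z = (\<chi> i. \<bar>x$i\<bar>)"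
      have "z \<noteq> 0" using \<open>x \<noteq> 0\<close> by (auto simp: z_def vec_eq_iff)
      have "(diag_scale \<epsilon> A *v z)$i = \<epsilon> i * (A *v x)$i" for i
      proof -
        have "\<epsilon> k * z$k = x$k" for k by (simp add: \<epsilon>_def z_def)
        then have "\<epsilon> i * \<epsilon> k * A$i$k * z$k = \<epsilon> i * (A$i$k * x$k)" for k by (metis mult.commute mult.left_commute)
        then show ?thesis
          unfolding diag_scale_def matrix_vector_mult_def vec_lambda_beta sum_distrib_left
          by (rule sum.cong[OF refl])
      qed
      then have "diag_scale \<epsilon> A *v z = 0" using Ax by (simp add: vec_eq_iff)
      moreover have "z$i \<ge> 0" for i by (simp add: z_def)
      ultimately have "nonneg_kernel (diag_scale \<epsilon> A)"
        using \<open>z \<noteq> 0\<close> unfolding nonneg_kernel_def by blast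
      moreover have "\<forall>i. \<epsilon> i \<in> {1, -1}" by (simp add: \<epsilon>_def)
      ultimately show ?thesis by blast
    qed
    moreover have "A \<in> spherical_grams \<longleftrightarrow> spherical_form A"
      using unit by (simp add: spherical_grams_eq[OF assms(1)])
    ultimately show ?thesis
      using spherical[OF sym unit] signed closure_subset[of spherical_grams] by blast
  qed
  show "A \<in> closure hyperbolic_grams \<longleftrightarrow>
        A \<in> closure euclidean_grams \<or>
        (det A < 0 \<and> (\<forall>i j. adj_on UNIV A i j \<ge> 0) \<and>
         (\<forall>S. card S = CARD('m) \<longrightarrow> psd_on S A))"
    unfolding euclidean_grams_eq[OF assms(1)] hyperbolic_grams_eq[OF assms(1)] psd_on_codim_1_iff
    by (rule closure_hyperbolic_form_iff[OF card sym unit])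
qed

end
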